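(* Let $d,m\ge1$ be integers and let $U\subseteq\mathbb{R}^m$ be an open set. Let $A_n\to A$ in $C^{0,1}(U,\mathrm{Herm}(d))$ as $n\to\infty$. Then, for each $1\le j\le m$ and almost every $x\in U$, $$\partial_j(\mathcal{E}(A_n))(x)\to\partial_j(\mathcal{E}(A))(x)\quad\text{as }n\to\infty.$$
   Context: $M_d(\mathbb{C})$ is the space of complex $d\times d$ matrices with the Frobenius norm $\|A\|_2=(\sum_{i,j}|a_{ij}|^2)^{1/2}$, and $\mathrm{Herm}(d)=\{A\in M_d(\mathbb{C}):A^*=A\}$. The map $\lambda^{\uparrow}:\mathrm{Herm}(d)\to\mathbb{R}^d$ assigns to $A$ its eigenvalues (with multiplicity) in increasing order; it is $1$-Lipschitz for the $2$-norms. The characteristic map is $\mathcal{E}(A)=\lambda^\uparrow\circ A$; it sends locally Lipschitz maps to locally Lipschitz maps, whose partial derivatives exist almost everywhere. For a bounded open set $V$, $C^{0,1}(\overline V,\mathrm{Herm}(d))$ carries the norm $\sup_{x\in V}\|f(x)\|_2+\sup_{x\neq y\in V}\frac{\|f(x)-f(y)\|_2}{\|x-y\|_2}$. $C^{0,1}(U,\mathrm{Herm}(d))$ is the space of maps $f:U\to\mathrm{Herm}(d)$ whose restriction to every relatively compact open $V\Subset U$ belongs to $C^{0,1}(\overline V,\mathrm{Herm}(d))$, with its natural Fréchet topology: $A_n\to A$ means $\|A_n-A\|_{C^{0,1}(\overline V)}\to0$ for every such $V$. "Almost every" refers to Lebesgue measure. *)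

theory Defs
  imports "HOL-Analysis.Analysis"
begin

text \<open>
  Matrices in $M_d(C)$ have type \<^typ>\<open>complex^'d^'d\<close>, where the index type \<open>'d\<close> is finite and,
  when eigenvalues have to be listed in order, linearly ordered, like $\{1,\dots,d\}$.
  The library norm on this type is the Frobenius norm, and the library norm on \<open>real^'m\<close>
  and \<open>real^'d\<close> is the Euclidean one.
\<close>

definition Herm :: "(complex^'d^'d) set" where
  "Herm = {A. \<forall>i j. cnj (A $ j $ i) = A $ i $ j}"

definition charpoly :: "complex^'d^'d \<Rightarrow> complex poly" where
  "charpoly A = det (\<chi> i j. (if i = j then [:0, 1:] else 0) - [:A $ i $ j:])"

text \<open>
  \<^const>\<open>proots\<close> is the multiset of roots counted with multiplicity. The eigenvalues of a Hermitian
  matrix are real, so taking real parts only changes their type; \<open>eig_up\<close> is meant to be used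
  on \<^const>\<open>Herm\<close> only. The entry of the sorted list at (zero-based) position
  \<open>card {j. j < i}\<close> goes to the index \<open>i\<close>.
\<close>

definition eig_up :: "complex^'d::_^'d::_ \<Rightarrow> real^'d::{finite,linorder}" where
  "eig_up A = (\<chi> i. sorted_list_of_multiset (image_mset Re (proots (charpoly A))) ! card {j. j < i})"

definition char_map :: "('x \<Rightarrow> complex^'d::_^'d::_) \<Rightarrow> 'x \<Rightarrow> real^'d::{finite,linorder}" where
  "char_map A = eig_up \<circ> A"

definition partially_differentiable_at ::
    "'m \<Rightarrow> (real^'m \<Rightarrow> 'b::real_normed_vector) \<Rightarrow> real^'m \<Rightarrow> bool" where
  "partially_differentiable_at j f x \<longleftrightarrow> (\<lambda>t::real. f (x + t *\<^sub>R axis j 1)) differentiable (at 0)"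

definition partial_deriv ::
    "'m \<Rightarrow> (real^'m \<Rightarrow> 'b::real_normed_vector) \<Rightarrow> real^'m \<Rightarrow> 'b" where
  "partial_deriv j f x = vector_derivative (\<lambda>t::real. f (x + t *\<^sub>R axis j 1)) (at 0)"

definition relatively_compact_open ::
    "'a::topological_space set \<Rightarrow> 'a set \<Rightarrow> bool" where
  "relatively_compact_open V U \<longleftrightarrow> open V \<and> compact (closure V) \<and> closure V \<subseteq> U"

definition C01_closure :: "(real^'m) set \<Rightarrow> (real^'m \<Rightarrow> complex^'d^'d) set" where
  "C01_closure V = {f. f ` closure V \<subseteq> Herm \<and> (\<exists>L. L-lipschitz_on (closure V) f)}"

text \<open>
  The suprema are taken in \<^typ>\<open>ennreal\<close>, so that suprema over empty sets are \<open>0\<close> and those of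
  unbounded families are infinite; the value is finite on \<open>C01_closure V\<close> for bounded \<open>V\<close>.
\<close>

definition C01_norm :: "(real^'m) set \<Rightarrow> (real^'m \<Rightarrow> complex^'d^'d) \<Rightarrow> ennreal" where
  "C01_norm V f =
     (SUP x\<in>V. ennreal (norm (f x))) +
     (SUP (x, y)\<in>{(x, y). x \<in> V \<and> y \<in> V \<and> x \<noteq> y}. ennreal (norm (f x - f y) / norm (x - y)))"

text \<open>
  Maps on \<open>U\<close> are total functions whose values outside \<open>U\<close> are irrelevant.
\<close>

definition C01 :: "(real^'m) set \<Rightarrow> (real^'m \<Rightarrow> complex^'d^'d) set" where
  "C01 U = {f. f ` U \<subseteq> Herm \<and> (\<forall>V. relatively_compact_open V U \<longrightarrow> f \<in> C01_closure V)}"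

definition C01_tendsto ::
    "(real^'m) set \<Rightarrow> (nat \<Rightarrow> real^'m \<Rightarrow> complex^'d^'d) \<Rightarrow> (real^'m \<Rightarrow> complex^'d^'d) \<Rightarrow> bool" where
  "C01_tendsto U F f \<longleftrightarrow>
     (\<forall>V. relatively_compact_open V U \<longrightarrow> (\<lambda>n. C01_norm V (\<lambda>x. F n x - f x)) \<longlonglongrightarrow> 0)"

end

theory Submission
  imports Defs
begin

text \<open>
  The sum \<open>S\<^sub>k\<close> of the \<open>k\<close> smallest eigenvalues is, by Ky Fan, a minimum of uniformly bounded
  linear functionals on the Hermitian matrices, hence Lipschitz with a supergradient everywhere.
  If \<open>G\<close> and \<open>S\<^sub>k \<circ> G\<close> are differentiable at \<open>0\<close>, then \<open>(S\<^sub>k \<circ> G)'(0)\<close> is the slope of a line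
  above \<open>h \<mapsto> S\<^sub>k (G 0 + h G'(0))\<close> touching it at \<open>0\<close>. Comparing with difference quotients for a
  fixed step \<open>h\<close> of either sign shows that these slopes converge when \<open>G 0\<close> and \<open>G'(0)\<close> do.
  At a point where all maps involved have a \<open>j\<close>-th partial derivative, convergence in \<open>C\<^sup>0\<^sup>,\<^sup>1\<close>
  gives convergence of \<open>G 0\<close> and \<open>G'(0)\<close>, and the eigenvalues are differences of the
  \<open>S\<^sub>k\<close>. Almost every point is of this kind: locally Lipschitz maps are differentiable almost
  everywhere on lines by Vitali's covering theorem, and null sets on lines add up by Tonelli.
\<close>

section \<open>Lipschitz functions have directional derivatives almost everywhere\<close>

text \<open>Quotients above \<open>q\<close> are captured by \<open>low_slope e (- q) (\<lambda>x. - f x)\<close>. Requiring the segments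
  to straddle the point strictly makes these sets Borel.\<close>

definition low_slope :: "'a::real_normed_vector \<Rightarrow> real \<Rightarrow> ('a \<Rightarrow> real) \<Rightarrow> 'a set" where
  "low_slope e p f = {x. \<forall>n. \<exists>a b. a < 0 \<and> 0 < b \<and> b - a < inverse (real (Suc n)) \<and>
      f (x + b *\<^sub>R e) - f (x + a *\<^sub>R e) < p * (b - a)}"

lemma not_low_slopeE:
  assumes "x \<notin> low_slope e p f"
  obtains n where "\<And>a b. a < 0 \<Longrightarrow> 0 < b \<Longrightarrow> b - a < inverse (real (Suc n)) \<Longrightarrow>
    p * (b - a) \<le> f (x + b *\<^sub>R e) - f (x + a *\<^sub>R e)"
  using assms unfolding low_slope_def mem_Collect_eq by (meson not_less)

lemma borel_low_slope:
  fixes f :: "'a::real_normed_vector \<Rightarrow> real"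
  assumes "continuous_on UNIV f"
  shows "low_slope e p f \<in> sets borel"
proof -
  \<comment> \<open>The inner union is uncountable, so openness of each member, not just
    measurability, is what makes it Borel; only the intersection over \<open>n\<close> is
    countable.\<close>
  have "low_slope e p f = (\<Inter>n. \<Union>(a, b)\<in>{(a, b). a < 0 \<and> 0 < b \<and> b - a < inverse (real (Suc n))}.
      {x. f (x + b *\<^sub>R e) - f (x + a *\<^sub>R e) < p * (b - a)})"
    unfolding low_slope_def by fastforce
  moreover have "open {x. f (x + b *\<^sub>R e) - f (x + a *\<^sub>R e) < p * (b - a)}" for a b
    by (intro open_Collect_less continuous_intros continuous_on_compose2[OF assms]) auto
  ultimately show ?thesis
    by (simp, intro sets.countable_INT) (auto intro!: borel_open)
qed

lemma low_slope_add_linear: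
  fixes f :: "real \<Rightarrow> real"
  shows "low_slope 1 (p + c) (\<lambda>x. f x + c * x) = low_slope 1 p f"
  unfolding low_slope_def by (simp add: algebra_simps)

lemma low_slope_line:
  "x + t *\<^sub>R e \<in> low_slope e p f \<longleftrightarrow> t \<in> low_slope 1 p (\<lambda>s. f (x + s *\<^sub>R e))"
  unfolding low_slope_def by (simp add: algebra_simps)

section \<open>Vitali coverings and exceptional slopes on the line\<close>

text \<open>Vitali's theorem selects countably many disjoint balls covering almost all of
  \<open>E\<close>, and countable additivity of both measures adds up the inequalities between
  balls. Passing to open balls loses only spheres, which are Lebesgue null, and yields an open
  \<open>V\<close>, inside which a second cover can be chosen.\<close>

lemma vitali_cover_comparison:
  fixes E S :: "'a::euclidean_space set"
  assumes sets: "sets M = sets borel" "sets N = sets borel" and S: "S \<in> sets borel"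
    and E: "\<And>x d. x \<in> E \<Longrightarrow> 0 < d \<Longrightarrow> \<exists>a r. 0 < r \<and> r < d \<and> x \<in> cball a r \<and> cball a r \<subseteq> S \<and>
        emeasure M (cball a r) \<le> emeasure N (cball a r)"
  obtains V where "open V" "V \<subseteq> S" "negligible (E - V)" "emeasure M V \<le> emeasure N S"
proof -
  define K where "K = {(a, r). 0 < r \<and> cball a r \<subseteq> S \<and> emeasure M (cball a r) \<le> emeasure N (cball a r)}"
  let ?B = "\<lambda>i. cball (fst i) (snd i)"
  have 1: "0 < snd i" if "i \<in> K" for i using that by (auto simp: K_def)
  have 2: "\<exists>i. i \<in> K \<and> x \<in> ?B i \<and> snd i < d" if "x \<in> E" "0 < d" for x d
    using E[OF that] by (auto simp: K_def)
  from 1 2 obtain C where C: "countable C" "C \<subseteq> K" "pairwise (\<lambda>i j. disjnt (?B i) (?B j)) C"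
     "negligible (E - (\<Union>i \<in> C. ?B i))"
    by (rule Vitali_covering_theorem_cballs[of K snd E fst])
  have CK: "?B i \<subseteq> S" "emeasure M (?B i) \<le> emeasure N (?B i)" if "i \<in> C" for i
    using subsetD[OF C(2) that] by (simp_all add: K_def split_def)
  define V where "V = (\<Union>i\<in>C. ball (fst i) (snd i))"
  have disj: "disjoint_family_on ?B C"
    using C(3) unfolding pairwise_def disjoint_family_on_def disjnt_def by blast
  have [measurable]: "?B i \<in> sets M" "?B i \<in> sets N" for i
    using sets by auto
  show thesis
  proof
    show "open V" unfolding V_def by auto
    show "V \<subseteq> S" unfolding V_def using CK(1) ball_subset_cball by blast
    have "negligible (\<Union>i\<in>C. sphere (fst i) (snd i))"
      using C(1) by (intro negligible_countable_Union) (auto simp: negligible_sphere)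
    moreover have "E - V \<subseteq> (E - (\<Union>i \<in> C. ?B i)) \<union> (\<Union>i\<in>C. sphere (fst i) (snd i))"
      
    proof
      fix x assume x: "x \<in> E - V"
      show "x \<in> (E - (\<Union>i \<in> C. ?B i)) \<union> (\<Union>i\<in>C. sphere (fst i) (snd i))"
      proof (cases "x \<in> (\<Union>i \<in> C. ?B i)")
        case True
        then obtain i where i: "i \<in> C" "x \<in> ?B i" by blast
        then have "x \<notin> ball (fst i) (snd i)" using x unfolding V_def by blast
        then have "x \<in> sphere (fst i) (snd i)" using i(2) by simp
        then show ?thesis using i(1) by blast
      qed (use x in blast)
    qed
    ultimately show "negligible (E - V)"
      using negligible_subset[OF negligible_Un[OF C(4)]] by simp
    have "emeasure M V \<le> emeasure M (\<Union>i \<in> C. ?B i)"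
      using C(1) sets by (intro emeasure_mono sets.countable_UN') (auto simp: V_def)
    also have "\<dots> = (\<integral>\<^sup>+i. emeasure M (?B i) \<partial>count_space C)"
      using sets by (intro emeasure_UN_countable C disj) auto
    also have "\<dots> \<le> (\<integral>\<^sup>+i. emeasure N (?B i) \<partial>count_space C)"
      using CK(2) by (intro nn_integral_mono) auto
    also have "\<dots> = emeasure N (\<Union>i \<in> C. ?B i)"
      using sets by (intro emeasure_UN_countable[symmetric] C disj) auto
    also have "\<dots> \<le> emeasure N S"
      using CK(1) S sets by (intro emeasure_mono UN_least) auto
    finally show "emeasure M V \<le> emeasure N S" .
  qed
qed

text \<open>The segment from \<open>x + a\<close> to \<open>x + b\<close> is rewritten by its
  midpoint and half length, the form in which Vitali's theorem for balls accepts it.\<close>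

lemma low_slope_small_cball:
  fixes f :: "real \<Rightarrow> real"
  assumes "x \<in> low_slope 1 p f" "0 < d" "open S" "x \<in> S"
  obtains c r where "0 < r" "r < d" "x \<in> cball c r" "cball c r \<subseteq> S"
    "f (c + r) - f (c - r) < p * (2 * r)"
proof -
  obtain \<delta> where \<delta>: "\<delta> > 0" "cball x \<delta> \<subseteq> S"
    using assms(3,4) open_contains_cball by blast
  obtain n where n: "inverse (real (Suc n)) < min d \<delta>"
    using reals_Archimedean[of "min d \<delta>"] \<delta>(1) assms(2) by auto
  obtain a b where ab: "a < 0" "0 < b" "b - a < inverse (real (Suc n))"
      "f (x + b) - f (x + a) < p * (b - a)"
    using assms(1) unfolding low_slope_def real_scaleR_def mult_1_right mem_Collect_eq by blast
  have "b - a < \<delta>" using ab(3) n by linarith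
  show thesis
  proof
    show "0 < (b - a) / 2" "(b - a) / 2 < d" using ab n assms(2) by auto
    show "x \<in> cball (x + (a + b) / 2) ((b - a) / 2)"
      using ab by (auto simp: cball_eq_atLeastAtMost field_simps)
    show "cball (x + (a + b) / 2) ((b - a) / 2) \<subseteq> S"
      using ab \<open>b - a < \<delta>\<close> by (intro order_trans[OF _ \<delta>(2)]) (auto simp: cball_eq_atLeastAtMost field_simps)
    have "x + (a + b) / 2 + (b - a) / 2 = x + b" "x + (a + b) / 2 - (b - a) / 2 = x + a"
      by (auto simp: field_simps)
    then show "f (x + (a + b) / 2 + (b - a) / 2) - f (x + (a + b) / 2 - (b - a) / 2)
        < p * (2 * ((b - a) / 2))"
      using ab(4) by (simp only:)
  qed
qed

text \<open>Two nested Vitali covers compare Lebesgue measure with the Stieltjes measure of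
  \<open>f\<close>. The outer intervals have Stieltjes measure at most \<open>p\<close> times their
  length, the inner ones at least \<open>q\<close> times. As the open set around the exceptional set
  can be chosen with almost the same measure, \<open>p < q\<close> forces that measure to
  vanish.\<close>

lemma negligible_low_slope_mono:
  fixes f :: "real \<Rightarrow> real"
  assumes "mono f" "continuous_on UNIV f" "p < q"
  shows "negligible (low_slope 1 p f \<inter> low_slope 1 (- q) (\<lambda>x. - f x))" (is "negligible ?E")
proof (cases "p \<le> 0")
  case True
  have "low_slope 1 p f = {}"
  proof (rule ccontr)
    assume "low_slope 1 p f \<noteq> {}"
    then obtain x where "x \<in> low_slope 1 p f" by auto
    then obtain a b where ab: "a < 0" "0 < b" "f (x + b) - f (x + a) < p * (b - a)"
      unfolding low_slope_def by auto
    have "f (x + a) \<le> f (x + b)" using ab by (intro monoD[OF assms(1)]) auto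
    moreover have "p * (b - a) \<le> 0" using True ab by (simp add: mult_nonpos_nonneg)
    ultimately show False using ab(3) by linarith
  qed
  then show ?thesis by simp
next
  case False
  then have p: "0 < p" by simp
  let ?\<mu> = "interval_measure f"
  have \<mu>: "emeasure ?\<mu> (cball c r) = ennreal (f (c + r) - f (c - r))" if "0 < r" for c r
    unfolding cball_eq_atLeastAtMost using that assms
    by (intro emeasure_interval_measure_Icc) (auto dest: monoD)
  have \<lambda>: "ennreal k * emeasure lborel (cball c r) = ennreal (k * (2 * r))" if "0 < r" "0 < k" for c r k :: real
    unfolding cball_eq_atLeastAtMost using that by (simp add: ennreal_mult[symmetric])
  show ?thesis unfolding negligible_on_intervals[of ?E]
  proof (intro allI)
    fix u v :: real
    \<comment> \<open>Cutting down to a box makes the measure finite, so that it can be cancelled in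
      the final comparison.\<close>
    define F where "F = ?E \<inter> cbox u v"
    have F: "F \<in> sets borel"
      unfolding F_def using assms(2)
      by (intro sets.Int borel_low_slope) (auto intro!: continuous_intros)
    have "emeasure lborel F \<le> emeasure lborel (cbox u v)"
      by (intro emeasure_mono) (auto simp: F_def)
    then have fin: "emeasure lborel F < \<infinity>"
      using emeasure_lborel_cbox_finite[of u v] by (simp add: le_less_trans)
    have Flm: "F \<in> lmeasurable"
      using F fin by (intro fmeasurableI) auto
    define s where "s = measure lebesgue F"
    have s: "emeasure lborel F = ennreal s"
    proof -
    have "emeasure lborel F = emeasure lebesgue F" using F by simp
    also have "\<dots> = ennreal s" unfolding s_def by (rule emeasure_eq_measure2[OF Flm])
    finally show ?thesis .
  qed
    have key: "q * s \<le> p * (s + \<epsilon>)" if e0: "\<epsilon> > 0" for \<epsilon>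
    proof -
      obtain S where S: "open S" "F \<subseteq> S" "S - F \<in> lmeasurable" "emeasure lebesgue (S - F) < ennreal \<epsilon>"
        using sets_lebesgue_outer_open[of F \<epsilon>] Flm e0 by blast
      have "emeasure lborel S = emeasure lborel (F \<union> (S - F))"
        using S(2) by (simp add: Un_absorb1)
      also have "\<dots> \<le> emeasure lborel F + emeasure lborel (S - F)"
        using F S(1) by (intro emeasure_subadditive) auto
      also have "emeasure lborel (S - F) = emeasure lebesgue (S - F)"
        using F S(1) by simp
      also have "emeasure lborel F + \<dots> \<le> ennreal (s + \<epsilon>)"
        using S(4) that unfolding s by (simp add: s_def ennreal_plus add_left_mono less_imp_le)
      finally have Sle: "emeasure lborel S \<le> ennreal (s + \<epsilon>)" .
      have c1: "\<exists>a r. 0 < r \<and> r < d \<and> x \<in> cball a r \<and> cball a r \<subseteq> S \<and>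
          emeasure ?\<mu> (cball a r) \<le> emeasure (scale_measure (ennreal p) lborel) (cball a r)"
        if x: "x \<in> F" "0 < d" for x d
      proof -
        have "x \<in> low_slope 1 p f" "x \<in> S" using x S(2) by (auto simp: F_def)
        from low_slope_small_cball[OF this(1) x(2) S(1) this(2)]
        obtain c r where "0 < r" "r < d" "x \<in> cball c r" "cball c r \<subseteq> S" "f (c + r) - f (c - r) < p * (2 * r)" .
        then show ?thesis using p
          by (intro exI[of _ c] exI[of _ r]) (auto simp: \<mu> \<lambda> intro!: ennreal_leI)
      qed
      obtain V where V: "open V" "V \<subseteq> S" "negligible (F - V)"
          "emeasure ?\<mu> V \<le> emeasure (scale_measure (ennreal p) lborel) S"
        using vitali_cover_comparison[of ?\<mu> "scale_measure (ennreal p) lborel" S F, OF _ _ _ c1] S(1) by auto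
      \<comment> \<open>The second cover is chosen inside \<open>V\<close>, whose Stieltjes measure
        is already controlled. This gives the chain from \<open>q\<close> times the length of
        \<open>W\<close> through the Stieltjes measure of \<open>V\<close> to \<open>p\<close> times
        the length of \<open>S\<close>.\<close>
      have c2: "\<exists>a r. 0 < r \<and> r < d \<and> x \<in> cball a r \<and> cball a r \<subseteq> V \<and>
          emeasure (scale_measure (ennreal q) lborel) (cball a r) \<le> emeasure ?\<mu> (cball a r)"
        if x: "x \<in> F \<inter> V" "0 < d" for x d
      proof -
        have "x \<in> low_slope 1 (- q) (\<lambda>x. - f x)" "x \<in> V" using x by (auto simp: F_def)
        from low_slope_small_cball[OF this(1) x(2) V(1) this(2)]
        obtain c r where "0 < r" "r < d" "x \<in> cball c r" "cball c r \<subseteq> V" "- f (c + r) - - f (c - r) < - q * (2 * r)" .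
        then show ?thesis using p \<open>p < q\<close>
          by (intro exI[of _ c] exI[of _ r]) (auto simp: \<mu> \<lambda> intro!: ennreal_leI)
      qed
      obtain W where W: "open W" "W \<subseteq> V" "negligible (F \<inter> V - W)"
          "emeasure (scale_measure (ennreal q) lborel) W \<le> emeasure ?\<mu> V"
        using vitali_cover_comparison[of "scale_measure (ennreal q) lborel" ?\<mu> V "F \<inter> V", OF _ _ _ c2] V(1) by auto
      have "negligible (F - W)"
        by (rule negligible_subset[OF negligible_Un[OF V(3) W(3)]]) auto
      then have "emeasure lborel (F - W) = 0"
        using F W(1) by (simp add: negligible_iff_emeasure0)
      have "emeasure lborel F \<le> emeasure lborel (W \<union> (F - W))"
        using F W(1) by (intro emeasure_mono) auto
      also have "\<dots> \<le> emeasure lborel W + emeasure lborel (F - W)"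
        using F W(1) by (intro emeasure_subadditive) auto
      finally have FW: "emeasure lborel F \<le> emeasure lborel W"
        using \<open>emeasure lborel (F - W) = 0\<close> by simp
      have "ennreal (q * s) = ennreal q * emeasure lborel F"
        using p \<open>p < q\<close> by (simp add: s ennreal_mult s_def)
      also have "\<dots> \<le> ennreal q * emeasure lborel W"
        using FW by (intro mult_left_mono) auto
      also have "\<dots> \<le> ennreal p * emeasure lborel S"
        using W(4) V(4) by simp
      also have "\<dots> \<le> ennreal p * ennreal (s + \<epsilon>)"
        using Sle by (intro mult_left_mono) auto
      also have "\<dots> = ennreal (p * (s + \<epsilon>))"
        using p by (simp add: ennreal_mult'[symmetric])
      finally show ?thesis
        using p that by (subst (asm) ennreal_le_iff) (auto simp: s_def)
    qed
    have "s = 0"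
    proof (rule ccontr)
      assume "s \<noteq> 0"
      then have "s > 0" by (simp add: s_def less_le)
      \<comment> \<open>This excess makes \<open>p * \<epsilon>\<close> equal to half of the gap
        \<open>(q - p) * s\<close>.\<close>
      have "q * s \<le> p * (s + (q - p) * s / (2 * p))"
        using p \<open>p < q\<close> \<open>s > 0\<close> by (intro key) auto
      also have "\<dots> = p * s + (q - p) * s / 2" using p by (simp add: field_simps)
      finally have "(q - p) * s \<le> (q - p) * s / 2" unfolding left_diff_distrib by linarith
      moreover have "(q - p) * s > 0" using \<open>p < q\<close> \<open>s > 0\<close> by simp
      ultimately show False by linarith
    qed
    then show "negligible (?E \<inter> cbox u v)"
      using s F by (simp add: F_def negligible_iff_emeasure0)
  qed
qed

text \<open>Adding \<open>L * x\<close> makes the function monotone and shifts every difference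
  quotient by \<open>L\<close>, so the monotone case applies with both thresholds moved by
  \<open>L\<close>.\<close>

lemma negligible_low_slope_lipschitz:
  fixes f :: "real \<Rightarrow> real"
  assumes "L-lipschitz_on UNIV f" "p < q"
  shows "negligible (low_slope 1 p f \<inter> low_slope 1 (- q) (\<lambda>x. - f x))"
proof -
  have "mono (\<lambda>x. f x + L * x)"
  proof (rule monoI)
    fix x y :: real assume "x \<le> y"
    then show "f x + L * x \<le> f y + L * y"
      using lipschitz_onD[OF assms(1), of x y] by (auto simp: dist_real_def algebra_simps)
  qed
  moreover have "continuous_on UNIV (\<lambda>x. f x + L * x)"
    by (intro continuous_intros lipschitz_on_continuous_on[OF assms(1)])
  ultimately have "negligible (low_slope 1 (p + L) (\<lambda>x. f x + L * x) \<inter>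
      low_slope 1 (- (q + L)) (\<lambda>x. - (f x + L * x)))"
    using assms(2) by (intro negligible_low_slope_mono) auto
  moreover have "low_slope 1 (- (q + L)) (\<lambda>x. - (f x + L * x)) = low_slope 1 (- q) (\<lambda>x. - f x)"
    using low_slope_add_linear[of "- q" "- L" "\<lambda>x. - f x"] by simp
  ultimately show ?thesis by (simp add: low_slope_add_linear)
qed

text \<open>If no rational gap separates small from large straddling quotients, their lower and
  upper limits coincide, and by continuity this common value is the derivative. Rational thresholds
  are asked for so that the non-differentiability set is covered by countably many exceptional
  sets.\<close>

lemma not_differentiable_low_slope:
  fixes f :: "'a::real_normed_vector \<Rightarrow> real"
  assumes f: "L-lipschitz_on UNIV f" and nd: "\<not> (\<lambda>t::real. f (x + t *\<^sub>R e)) differentiable (at 0)"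
  obtains (slopes) p q where "p \<in> \<rat>" "q \<in> \<rat>" "p < q" "x \<in> low_slope e p f" "x \<in> low_slope e (- q) (\<lambda>x. - f x)"
proof (rule ccontr)
  assume nt: "\<not> thesis"
  have no: False if "p \<in> \<rat>" "q \<in> \<rat>" "p < q" "x \<in> low_slope e p f" "x \<in> low_slope e (- q) (\<lambda>x. - f x)" for p q
    by (rule notE[OF nt slopes[OF that]])
  define g where "g = (\<lambda>t. f (x + t *\<^sub>R e))"
  define M where "M = L * norm e + 1"
  have L: "L \<ge> 0" using f by (rule lipschitz_on_nonneg)
  have gl: "\<bar>g b - g a\<bar> \<le> L * norm e * (b - a)" if "a < b" for a b
  proof -
    have "dist (x + b *\<^sub>R e) (x + a *\<^sub>R e) = (b - a) * norm e"
      using that by (simp add: dist_norm scaleR_diff_left[symmetric])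
    then show ?thesis
      using lipschitz_onD[OF f, of "x + b *\<^sub>R e" "x + a *\<^sub>R e"]
      by (simp only: g_def dist_real_def mult_ac UNIV_I)
  qed
  \<comment> \<open>The infimum of \<open>P\<close> is the lower limit of the straddling quotients, and will be the derivative.\<close>
  define P where "P = {p. x \<in> low_slope e p f}"
  have up: "p' \<in> P" if pP: "p \<in> P" "p \<le> p'" for p p'
    unfolding P_def low_slope_def mem_Collect_eq
  proof
    fix n
    obtain a b where ab: "a < 0 \<and> 0 < b \<and> b - a < inverse (real (Suc n)) \<and>
      f (x + b *\<^sub>R e) - f (x + a *\<^sub>R e) < p * (b - a)"
      using pP(1) unfolding P_def low_slope_def by blast
    moreover have "p * (b - a) \<le> p' * (b - a)" using ab that(2) by (intro mult_right_mono) auto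
    ultimately show "\<exists>a b. a < 0 \<and> 0 < b \<and> b - a < inverse (real (Suc n)) \<and>
      f (x + b *\<^sub>R e) - f (x + a *\<^sub>R e) < p' * (b - a)" by (meson less_le_trans)
  qed
  have MP: "M \<in> P" unfolding P_def low_slope_def mem_Collect_eq
  proof
    fix n
    define h where "h = inverse (real (Suc n)) / 3"
    have h: "h > 0" by (simp add: h_def)
    have "g h - g (-h) \<le> L * norm e * (h - (-h))" using gl[of "-h" h] h by auto
    also have "\<dots> < M * (h - (-h))" using h by (simp add: M_def)
    finally show "\<exists>a b. a < 0 \<and> 0 < b \<and> b - a < inverse (real (Suc n)) \<and>
      f (x + b *\<^sub>R e) - f (x + a *\<^sub>R e) < M * (b - a)"
      using h by (intro exI[of _ "-h"] exI[of _ h]) (auto simp: g_def h_def)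
  qed
  have Pb: "- M \<le> p" if pP: "p \<in> P" for p
  proof -
    obtain a b where ab: "a < 0" "0 < b" "g b - g a < p * (b - a)"
      using pP unfolding P_def low_slope_def g_def by blast
    then have "- (L * norm e) * (b - a) < p * (b - a)" using gl[of a b] by (auto simp: abs_le_iff)
    then have "- (L * norm e) < p" using ab by (simp only: mult_less_cancel_right_disj) auto
    then show ?thesis by (simp add: M_def)
  qed
  then have bdd: "bdd_below P" by (rule bdd_belowI)
  define D where "D = Inf P"
  have sand: "\<exists>\<delta>>0. \<forall>a b. a < 0 \<longrightarrow> 0 < b \<longrightarrow> b - a < \<delta> \<longrightarrow> \<bar>g b - g a - D * (b - a)\<bar> \<le> \<epsilon> * (b - a)"
    if e0: "\<epsilon> > 0" for \<epsilon>
  proof -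
    have "D - \<epsilon> \<notin> P" using cInf_lower[OF _ bdd, of "D - \<epsilon>"] that by (auto simp: D_def)
    then obtain n where n: "\<And>a b. a < 0 \<Longrightarrow> 0 < b \<Longrightarrow> b - a < inverse (real (Suc n)) \<Longrightarrow>
      g b - g a \<ge> (D - \<epsilon>) * (b - a)"
      unfolding P_def mem_Collect_eq g_def by (rule not_low_slopeE) blast
    have "\<exists>p\<in>P. p < D + \<epsilon> / 2"
      using cInf_less_iff[of P "D + \<epsilon> / 2"] MP bdd that by (auto simp: D_def)
    then obtain p where p: "p \<in> P" "p < D + \<epsilon> / 2" by blast
    \<comment> \<open>Two rationals on either side of \<open>D + \<epsilon> / 2\<close>. Since
      \<open>p'\<close> lies above an element of \<open>P\<close>, the point is in its set; the
      assumed absence of a gap then makes \<open>q\<close>, hence \<open>D + \<epsilon>\<close>, an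
      upper bound for all quotients over short segments.\<close>
    obtain p' where p': "p' \<in> \<rat>" "p < p'" "p' < D + \<epsilon> / 2" using Rats_dense_in_real[OF p(2)] by blast
    obtain q where q: "q \<in> \<rat>" "D + \<epsilon> / 2 < q" "q < D + \<epsilon>"
      using Rats_dense_in_real[of "D + \<epsilon> / 2" "D + \<epsilon>"] e0 by auto
    have "x \<in> low_slope e p' f" using up[OF p(1), of p'] p' by (auto simp: P_def)
    then have "x \<notin> low_slope e (- q) (\<lambda>x. - f x)" using no[of p' q] p' q by auto
    then obtain m where m: "\<And>a b. a < 0 \<Longrightarrow> 0 < b \<Longrightarrow> b - a < inverse (real (Suc m)) \<Longrightarrow>
      - q * (b - a) \<le> - g b - - g a"
      unfolding g_def by (rule not_low_slopeE) blast
    show ?thesis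
    proof (intro exI[of _ "min (inverse (real (Suc n))) (inverse (real (Suc m)))"] conjI allI impI)
      fix a b :: real
      assume ab: "a < 0" "0 < b" "b - a < min (inverse (real (Suc n))) (inverse (real (Suc m)))"
      have "q * (b - a) \<le> (D + \<epsilon>) * (b - a)" using q ab by (intro mult_right_mono) auto
      then show "\<bar>g b - g a - D * (b - a)\<bar> \<le> \<epsilon> * (b - a)"
        using n[of a b] m[of a b] ab by (auto simp: abs_le_iff algebra_simps)
    qed auto
  qed
  have gc: "continuous_on UNIV g"
    unfolding g_def
    by (intro continuous_on_compose2[OF lipschitz_on_continuous_on[OF f]] continuous_intros) auto
  then have gt: "(g \<longlongrightarrow> g 0) (at 0 within X)" for X
    by (metis UNIV_I continuous_on_def tendsto_within_subset top_greatest)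
  have "(g has_derivative (\<lambda>t. D * t)) (at 0)"
    unfolding has_derivative_at_alt
  proof (intro conjI allI impI)
    fix \<epsilon> :: real assume "\<epsilon> > 0"
    then obtain \<delta> where \<delta>: "\<delta> > 0" "\<And>a b. a < 0 \<Longrightarrow> 0 < b \<Longrightarrow> b - a < \<delta> \<Longrightarrow> \<bar>g b - g a - D * (b - a)\<bar> \<le> \<epsilon> * (b - a)"
      using sand by blast
    \<comment> \<open>Strictly straddling segments never have \<open>0\<close> as an endpoint. The
      one-sided estimate is obtained by letting the other endpoint tend to \<open>0\<close> and
      using continuity of \<open>g\<close>.\<close>
    have pos: "\<bar>g b - g 0 - D * b\<bar> \<le> \<epsilon> * b" if b: "0 < b" "b < \<delta>" for b
    proof -
      have ev: "eventually (\<lambda>a. \<bar>g b - g a - D * (b - a)\<bar> \<le> \<epsilon> * (b - a)) (at_left 0)"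
        using b \<delta>(2) by (auto simp: eventually_at_left_field intro!: exI[of _ "b - \<delta>"])
      have "((\<lambda>a. \<bar>g b - g a - D * (b - a)\<bar>) \<longlongrightarrow> \<bar>g b - g 0 - D * (b - 0)\<bar>) (at_left 0)"
           "((\<lambda>a. \<epsilon> * (b - a)) \<longlongrightarrow> \<epsilon> * (b - 0)) (at_left 0)"
        by (intro tendsto_intros gt)+
      from tendsto_le[OF _ this(2,1) ev] show ?thesis by simp
    qed
    have neg: "\<bar>g 0 - g a + D * a\<bar> \<le> \<epsilon> * (- a)" if a: "a < 0" "- \<delta> < a" for a
    proof -
      have ev: "eventually (\<lambda>b. \<bar>g b - g a - D * (b - a)\<bar> \<le> \<epsilon> * (b - a)) (at_right 0)"
        using a \<delta>(2) by (auto simp: eventually_at_right_field intro!: exI[of _ "a + \<delta>"])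
      have "((\<lambda>b. \<bar>g b - g a - D * (b - a)\<bar>) \<longlongrightarrow> \<bar>g 0 - g a - D * (0 - a)\<bar>) (at_right 0)"
           "((\<lambda>b. \<epsilon> * (b - a)) \<longlongrightarrow> \<epsilon> * (0 - a)) (at_right 0)"
        by (intro tendsto_intros gt)+
      from tendsto_le[OF _ this(2,1) ev] show ?thesis by simp
    qed
    show "\<exists>d>0. \<forall>y. norm (y - 0) < d \<longrightarrow> norm (g y - g 0 - D * (y - 0)) \<le> \<epsilon> * norm (y - 0)"
    proof (intro exI[of _ \<delta>] conjI allI impI \<delta>(1))
      fix y :: real assume "norm (y - 0) < \<delta>"
      then show "norm (g y - g 0 - D * (y - 0)) \<le> \<epsilon> * norm (y - 0)"
        using pos[of y] neg[of y] abs_minus_commute[of "g 0 - g y" "- (D * y)"]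
        by (cases y "0::real" rule: linorder_cases) (auto simp: algebra_simps)
    qed
  qed (rule bounded_linear_mult_right)
  then have "g differentiable (at 0)" unfolding differentiable_def by blast
  then show False using nd by (simp add: g_def)
qed

text \<open>Averaging the translates of \<open>N\<close> along \<open>e\<close> avoids any splitting of coordinates.\<close>

lemma null_sets_if_null_on_lines:
  fixes N :: "'a::euclidean_space set"
  assumes N: "N \<in> sets borel" and line: "\<And>x. negligible {t::real. x + t *\<^sub>R e \<in> N}"
  shows "N \<in> null_sets lborel"
proof -
  have [measurable]: "N \<in> sets borel" by (rule N)
  have [measurable]: "(\<lambda>(t, x). x + t *\<^sub>R e) \<in> (lborel :: real measure) \<Otimes>\<^sub>M (lborel :: 'a measure) \<rightarrow>\<^sub>M borel"
    by measurable
  have shift: "(\<integral>\<^sup>+x. indicator N (x + t *\<^sub>R e) \<partial>lborel) = emeasure lborel N" for t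
  proof -
    have "emeasure lborel N = (\<integral>\<^sup>+x. indicator N x \<partial>lborel)" by simp
    also have "\<dots> = (\<integral>\<^sup>+x. indicator N x \<partial>distr lborel borel ((+) (t *\<^sub>R e)))"
      by (simp add: lborel_distr_plus)
    also have "\<dots> = (\<integral>\<^sup>+x. indicator N (x + t *\<^sub>R e) \<partial>lborel)"
      by (subst nn_integral_distr) (auto simp: add.commute)
    finally show ?thesis by simp
  qed
  have zero: "(\<integral>\<^sup>+t. indicator {0..1} t * indicator N (x + t *\<^sub>R e) \<partial>lborel) = 0" for x
  proof -
    let ?S = "{t::real. x + t *\<^sub>R e \<in> N}"
    have S: "?S \<in> sets borel" by measurable
    have "(\<integral>\<^sup>+t. indicator {0..1} t * indicator N (x + t *\<^sub>R e) \<partial>lborel) \<le> (\<integral>\<^sup>+t. indicator ?S t \<partial>lborel)"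
      by (intro nn_integral_mono) (auto simp: indicator_def)
    also have "\<dots> = emeasure lborel ?S" using S by simp
    also have "\<dots> = 0" using line[of x] S by (simp add: negligible_iff_emeasure0)
    finally show ?thesis by simp
  qed
  \<comment> \<open>The weight on the unit interval has integral 1, so averaging the translates
    reproduces the measure of \<open>N\<close>, even if it is infinite. After exchanging the
    integrals, the inner one runs along a line, where it vanishes.\<close>
  have "emeasure lborel N = (\<integral>\<^sup>+t. indicator {0..1::real} t * emeasure lborel N \<partial>lborel)"
    by (subst nn_integral_multc) auto
  also have "\<dots> = (\<integral>\<^sup>+t. (\<integral>\<^sup>+x. indicator {0..1::real} t * indicator N (x + t *\<^sub>R e) \<partial>lborel) \<partial>lborel)"
    by (intro nn_integral_cong) (simp add: nn_integral_cmult shift)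
  also have "\<dots> = (\<integral>\<^sup>+x. (\<integral>\<^sup>+t. indicator {0..1::real} t * indicator N (x + t *\<^sub>R e) \<partial>lborel) \<partial>lborel)"
    by (rule lborel_pair.Fubini') measurable
  also have "\<dots> = 0" by (simp add: zero)
  finally show ?thesis using N by (auto simp: null_sets_def)
qed

section \<open>Almost everywhere directional differentiability in Euclidean space\<close>

text \<open>The bad points lie in a countable union, over rational \<open>p < q\<close>, of Borel
  sets. Each of them meets every line in direction \<open>e\<close> in an exceptional set of a
  Lipschitz function of one variable.\<close>

lemma AE_directionally_differentiable_real:
  fixes f :: "'a::euclidean_space \<Rightarrow> real"
  assumes f: "L-lipschitz_on UNIV f"
  shows "AE x in lborel. (\<lambda>t::real. f (x + t *\<^sub>R e)) differentiable (at 0)"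
proof -
  define N where "N p q = low_slope e p f \<inter> low_slope e (- q) (\<lambda>x. - f x)" for p q
  have cont: "continuous_on UNIV f" by (rule lipschitz_on_continuous_on[OF f])
  have "N p q \<in> null_sets lborel" if "p < q" for p q
  proof (rule null_sets_if_null_on_lines)
    show "N p q \<in> sets borel"
      unfolding N_def by (intro sets.Int borel_low_slope continuous_intros cont)
    fix x
    have "(L * norm e)-lipschitz_on UNIV (\<lambda>s. f (x + s *\<^sub>R e))"
    proof (rule lipschitz_onI)
      fix s t :: real
      have "dist (f (x + s *\<^sub>R e)) (f (x + t *\<^sub>R e)) \<le> L * dist (x + s *\<^sub>R e) (x + t *\<^sub>R e)"
        by (rule lipschitz_onD[OF f]) auto
      also have "dist (x + s *\<^sub>R e) (x + t *\<^sub>R e) = norm e * dist s t"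
        by (simp add: dist_norm scaleR_diff_left[symmetric])
      finally show "dist (f (x + s *\<^sub>R e)) (f (x + t *\<^sub>R e)) \<le> L * norm e * dist s t"
        by (simp only: mult.assoc)
    qed (use lipschitz_on_nonneg[OF f] in auto)
    then have "negligible (low_slope 1 p (\<lambda>s. f (x + s *\<^sub>R e)) \<inter> low_slope 1 (- q) (\<lambda>s. - f (x + s *\<^sub>R e)))"
      using that by (rule negligible_low_slope_lipschitz)
    moreover have "{t. x + t *\<^sub>R e \<in> N p q} =
        low_slope 1 p (\<lambda>s. f (x + s *\<^sub>R e)) \<inter> low_slope 1 (- q) (\<lambda>s. - f (x + s *\<^sub>R e))"
      unfolding N_def by (auto simp: low_slope_line)
    ultimately show "negligible {t. x + t *\<^sub>R e \<in> N p q}" by simp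
  qed
  then have "(\<Union>(p, q)\<in>{(p, q). p \<in> \<rat> \<and> q \<in> \<rat> \<and> p < q}. N p q) \<in> null_sets lborel"
    by (intro null_sets_UN') (auto intro: countable_subset[OF _ countable_SIGMA[OF countable_rat countable_rat]])
  then show ?thesis
    by (rule AE_I') (auto simp: N_def elim!: not_differentiable_low_slope[OF f])
qed

text \<open>On a ball, composing with the nearest-point projection extends \<open>f\<close> to a
  globally Lipschitz map without changing it there, and real components reduce to the scalar case.
  By Lindelof, countably many such balls cover \<open>U\<close>.\<close>

lemma AE_directionally_differentiable:
  fixes f :: "'a::euclidean_space \<Rightarrow> 'b::euclidean_space"
  assumes U: "open U" and f: "\<And>x r. cball x r \<subseteq> U \<Longrightarrow> \<exists>L. L-lipschitz_on (cball x r) f"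
  shows "AE x in lborel. x \<in> U \<longrightarrow> (\<lambda>t::real. f (x + t *\<^sub>R e)) differentiable (at 0)"
proof -
  let ?P = "\<lambda>x. (\<lambda>t::real. f (x + t *\<^sub>R e)) differentiable (at 0)"
  have ball: "AE x in lborel. x \<in> ball c r \<longrightarrow> ?P x" if c: "cball c r \<subseteq> U" "0 < r" for c r
  proof -
    obtain L where L: "L-lipschitz_on (cball c r) f" using f[OF c(1)] by blast
    let ?\<pi> = "closest_point (cball c r)"
    have \<pi>: "?\<pi> x \<in> cball c r" for x using c(2) by (intro closest_point_in_set) auto
    have "L-lipschitz_on UNIV (\<lambda>x. f (?\<pi> x) \<bullet> b)" if b: "b \<in> Basis" for b
    proof (rule lipschitz_onI)
      fix x y
      have "dist (f (?\<pi> x) \<bullet> b) (f (?\<pi> y) \<bullet> b) \<le> dist (f (?\<pi> x)) (f (?\<pi> y))"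
        using Basis_le_norm[OF b] by (metis dist_norm inner_diff_left real_norm_def)
      also have "\<dots> \<le> L * dist (?\<pi> x) (?\<pi> y)" by (rule lipschitz_onD[OF L \<pi> \<pi>])
      also have "\<dots> \<le> L * dist x y"
        using c(2) by (intro mult_left_mono closest_point_lipschitz lipschitz_on_nonneg[OF L]) auto
      finally show "dist (f (?\<pi> x) \<bullet> b) (f (?\<pi> y) \<bullet> b) \<le> L * dist x y" .
    qed (rule lipschitz_on_nonneg[OF L])
    then have "AE x in lborel. \<forall>b\<in>Basis. (\<lambda>t::real. f (?\<pi> (x + t *\<^sub>R e)) \<bullet> b) differentiable (at 0)"
      by (subst AE_ball_countable) (auto intro: AE_directionally_differentiable_real[where f="\<lambda>x. f (?\<pi> x) \<bullet> _"] countable_finite)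
    then show ?thesis
    proof (rule AE_mp, intro AE_I2 impI)
      fix x assume d: "\<forall>b\<in>Basis. (\<lambda>t::real. f (?\<pi> (x + t *\<^sub>R e)) \<bullet> b) differentiable (at 0)"
        and x: "x \<in> ball c r"
      have "(\<lambda>t::real. f (?\<pi> (x + t *\<^sub>R e))) differentiable (at 0)"
        using d by (subst differentiable_componentwise_within) auto
      moreover have "open ((\<lambda>t::real. x + t *\<^sub>R e) -` ball c r)"
        by (intro open_vimage continuous_intros) auto
      moreover have "f (?\<pi> (x + t *\<^sub>R e)) = f (x + t *\<^sub>R e)" if "t \<in> (\<lambda>t::real. x + t *\<^sub>R e) -` ball c r" for t
        using that by (subst closest_point_self) auto
      moreover have "0 \<in> (\<lambda>t::real. x + t *\<^sub>R e) -` ball c r" using x by simp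
      ultimately show "?P x"
        unfolding differentiable_def by (meson has_derivative_transform_within_open)
    qed
  qed
  define B where "B = {ball c r | c r. cball c r \<subseteq> U \<and> 0 < r}"
  have "\<Union> B = U"
  proof
    show "U \<subseteq> \<Union> B"
    proof
      fix x assume "x \<in> U"
      then obtain r where "r > 0" "cball x r \<subseteq> U" using U open_contains_cball by blast
      then show "x \<in> \<Union> B" unfolding B_def by force
    qed
    show "\<Union> B \<subseteq> U" using ball_subset_cball by (auto simp: B_def subset_iff)
  qed
  obtain B' where B': "B' \<subseteq> B" "countable B'" "\<Union> B' = \<Union> B"
    using Lindelof[of B] by (auto simp: B_def)
  have "AE x in lborel. \<forall>V\<in>B'. x \<in> V \<longrightarrow> ?P x"
    using B'(1) ball by (subst AE_ball_countable[OF B'(2)]) (auto simp: B_def)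
  then show ?thesis
    by (rule AE_mp) (use B'(3) \<open>\<Union> B = U\<close> in auto)
qed

section \<open>Spectral theorem for Hermitian matrices\<close>

text \<open>Conjugate-linear in the first argument. Its real part is the inner product of the
  underlying real space, which lets real dimension counts and real minimisation be used for complex
  vectors.\<close>

definition cip :: "complex^'n \<Rightarrow> complex^'n \<Rightarrow> complex" where
  "cip u v = (\<Sum>i\<in>UNIV. cnj (u $ i) * v $ i)"

lemma cip_add_right: "cip u (v + w) = cip u v + cip u w"
  by (simp add: cip_def algebra_simps sum.distrib)

lemma cip_diff_right: "cip u (v - w) = cip u v - cip u w"
  by (simp add: cip_def algebra_simps sum_subtractf)

lemma cip_scale_right: "cip u (c *s v) = c * cip u v"
  by (simp add: cip_def sum_distrib_left mult_ac)

lemma cip_scale_left: "cip (c *s u) v = cnj c * cip u v"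
  by (simp add: cip_def sum_distrib_left mult_ac)

lemma cip_sum_right: "cip u (sum f S) = (\<Sum>i\<in>S. cip u (f i))"
  by (simp add: cip_def sum_distrib_left sum.swap[of _ S])

lemma cip_commute: "cip v u = cnj (cip u v)"
  by (simp add: cip_def mult.commute)

lemma cip_scaleR_right: "cip u (c *\<^sub>R v) = of_real c * cip u v"
  by (simp add: cip_def sum_distrib_left scaleR_conv_of_real[symmetric])

lemma Re_cip: "Re (cip u v) = u \<bullet> v"
  by (simp add: cip_def inner_vec_def inner_complex_def)

lemma cip_self: "cip v v = of_real ((norm v)\<^sup>2)"
proof -
  have "Im (cip v v) = 0" by (simp add: cip_def mult.commute)
  moreover have "Re (cip v v) = (norm v)\<^sup>2" by (simp add: Re_cip power2_norm_eq_inner)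
  ultimately show ?thesis by (simp add: complex_eq_iff)
qed

lemma continuous_on_cip [continuous_intros]:
  assumes "continuous_on S f" "continuous_on S g"
  shows "continuous_on S (\<lambda>x. cip (f x) (g x))"
  unfolding cip_def using assms
  by (intro continuous_intros)

lemma continuous_on_matrix_vector_mult [continuous_intros]:
  fixes A :: "complex^'n^'m"
  assumes "continuous_on S f"
  shows "continuous_on S (\<lambda>x. A *v f x)"
  unfolding matrix_vector_mult_def using assms
  by (intro continuous_intros)

lemma cip_Herm:
  assumes "A \<in> Herm"
  shows "cip (A *v x) y = cip x (A *v y)"
proof -
  have *: "cnj (A $ i $ j) = A $ j $ i" for i j using assms by (auto simp: Herm_def)
  have "cip (A *v x) y = (\<Sum>i\<in>UNIV. \<Sum>j\<in>UNIV. A $ j $ i * cnj (x $ j) * y $ i)"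
    by (simp add: cip_def matrix_vector_mult_def sum_distrib_right *)
  also have "\<dots> = (\<Sum>j\<in>UNIV. \<Sum>i\<in>UNIV. A $ j $ i * cnj (x $ j) * y $ i)"
    by (rule sum.swap)
  also have "\<dots> = cip x (A *v y)"
    by (simp add: cip_def matrix_vector_mult_def sum_distrib_left mult_ac)
  finally show ?thesis .
qed

text \<open>Complex orthogonality to \<open>u i\<close> is real orthogonality to both
  \<open>u i\<close> and its multiple by the imaginary unit. These are at most
  \<open>2 * card S\<close> vectors in a space of real dimension
  \<open>2 * CARD('n)\<close>.\<close>

lemma ex_orthogonal_vector:
  fixes u :: "'i \<Rightarrow> complex^'n"
  assumes "finite S" "card S < CARD('n)"
  obtains w where "w \<noteq> 0" "\<And>i. i \<in> S \<Longrightarrow> cip (u i) w = 0"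
proof -
  let ?X = "u ` S \<union> (\<lambda>i. \<i> *s u i) ` S"
  have "dim ?X \<le> card ?X" using assms(1) by (intro dim_le_card') auto
  also have "\<dots> \<le> card S + card S"
    using card_Un_le[of "u ` S" "(\<lambda>i. \<i> *s u i) ` S"] card_image_le[OF assms(1)]
    by (meson add_mono order_trans)
  also have "\<dots> < DIM(complex^'n)" using assms(2) by simp
  finally have "dim ?X < DIM(complex^'n)" .
  from orthogonal_to_subspace_exists[OF this]
  obtain w where w: "w \<noteq> 0" "\<And>y. y \<in> span ?X \<Longrightarrow> orthogonal w y"
    by blast
  have "cip (u i) w = 0" if "i \<in> S" for i
  proof -
    have "u i \<bullet> w = 0" "(\<i> *s u i) \<bullet> w = 0"
      using that w(2)[of "u i"] w(2)[of "\<i> *s u i"]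
      by (auto simp: span_base orthogonal_def inner_commute)
    then show ?thesis
      by (simp add: Re_cip[symmetric] cip_scale_left complex_eq_iff)
  qed
  with w(1) show thesis using that by blast
qed

text \<open>The first-order condition at a minimum: for small \<open>t\<close> of sign opposite to
  \<open>a\<close>, the linear term would outweigh the quadratic one.\<close>

lemma nonneg_quadratic_linear_coeff:
  fixes a c :: real
  assumes "\<And>t. 0 \<le> 2 * t * a + t\<^sup>2 * c"
  shows "a = 0"
proof (rule ccontr)
  assume "a \<noteq> 0"
  \<comment> \<open>The denominator is positive and at least \<open>c\<close> whatever the sign of
    \<open>c\<close>, so the quadratic term is at most \<open>- t * a\<close>, half of what the
    linear term takes away.\<close>
  define t where "t = - a / (1 + \<bar>c\<bar>)"
  have p: "1 + \<bar>c\<bar> > 0" by simp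
  have "t * (1 + \<bar>c\<bar>) = - a" using p by (simp add: t_def)
  have "t\<^sup>2 * c \<le> t\<^sup>2 * (1 + \<bar>c\<bar>)" by (intro mult_left_mono) auto
  also have "\<dots> = t * - a" using \<open>t * (1 + \<bar>c\<bar>) = - a\<close>
    by (simp only: power2_eq_square mult.assoc)
  finally have "0 \<le> t * a" using assms[of t] by simp
  moreover have "t * a < 0" using \<open>a \<noteq> 0\<close> p
    by (simp add: t_def field_simps flip: power2_eq_square)
  ultimately show False by simp
qed

text \<open>The new eigenvector minimises the quadratic form on the unit sphere of the orthogonal
  complement of the eigenvectors already found.\<close>

lemma Herm_orthonormal_eigenvectors:
  fixes A :: "complex^'n^'n" and S :: "'n set"
  assumes A: "A \<in> Herm"
  shows "\<exists>u l. (\<forall>i\<in>S. A *v u i = of_real (l i) *s u i) \<and>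
    (\<forall>i\<in>S. \<forall>j\<in>S. cip (u i) (u j) = (if i = j then 1 else 0))"
  using finite[of S]
proof (induction S rule: finite_induct)
  case (insert a S)
  from insert.IH obtain u l where "\<forall>i\<in>S. A *v u i = complex_of_real (l i) *s u i"
    "\<forall>i\<in>S. \<forall>j\<in>S. cip (u i) (u j) = (if i = j then 1 else 0)"
    by blast
  then have ul: "\<And>i. i \<in> S \<Longrightarrow> A *v u i = complex_of_real (l i) *s u i"
    "\<And>i j. i \<in> S \<Longrightarrow> j \<in> S \<Longrightarrow> cip (u i) (u j) = (if i = j then 1 else 0)"
    by blast+
  define W where "W = {w. \<forall>i\<in>S. cip (u i) w = 0}"
  have "card (insert a S) \<le> CARD('n)" by (rule card_mono) auto
  then have "card S < CARD('n)" using insert by simp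
  then obtain w where w0: "w \<noteq> 0" "\<And>i. i \<in> S \<Longrightarrow> cip (u i) w = 0"
    by (rule ex_orthogonal_vector[OF insert(1), where u = u]) blast
  then have w: "w \<noteq> 0" "w \<in> W" by (simp_all add: W_def)
  have Wsc: "c *\<^sub>R z \<in> W" if "z \<in> W" for c :: real and z
    using that by (simp add: W_def cip_scaleR_right)
  have Wadd: "y + z \<in> W" "y - z \<in> W" if "y \<in> W" "z \<in> W" for y z
    using that by (simp_all add: W_def cip_add_right cip_diff_right)
  \<comment> \<open>By symmetry of \<open>A\<close>, the orthogonal complement of eigenvectors is
    invariant; this keeps the residual \<open>z\<close> below inside \<open>W\<close>.\<close>
  have WA: "A *v z \<in> W" if "z \<in> W" for z
    using that by (simp add: W_def cip_Herm[OF A, symmetric] ul(1) cip_scale_left)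
  have "W = (\<Inter>i\<in>S. {w. cip (u i) w = 0})" by (auto simp: W_def)
  then have "closed W" by (auto intro!: closed_INT closed_Collect_eq continuous_intros)
  then have "compact (sphere 0 1 \<inter> W)" by (intro compact_Int_closed) auto
  moreover have "(1 / norm w) *\<^sub>R w \<in> sphere 0 1 \<inter> W" using w Wsc by auto
  moreover have "continuous_on (sphere 0 1 \<inter> W) (\<lambda>z. z \<bullet> (A *v z))"
    by (intro continuous_intros)
  ultimately have "\<exists>x\<in>sphere 0 1 \<inter> W. \<forall>y\<in>sphere 0 1 \<inter> W. x \<bullet> (A *v x) \<le> y \<bullet> (A *v y)"
    by (intro continuous_attains_inf) blast+
  then obtain w0 where w0: "norm w0 = 1" "w0 \<in> W"
    and "\<forall>y\<in>sphere 0 1 \<inter> W. w0 \<bullet> (A *v w0) \<le> y \<bullet> (A *v y)" by auto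
  then have min: "\<And>z. norm z = 1 \<Longrightarrow> z \<in> W \<Longrightarrow> w0 \<bullet> (A *v w0) \<le> z \<bullet> (A *v z)" by simp
  define \<mu> where "\<mu> = w0 \<bullet> (A *v w0)"
  have lin: "A *v (x + c *\<^sub>R y) = A *v x + c *\<^sub>R (A *v y)" for x y and c :: real
    by (simp add: vec_eq_iff matrix_vector_mult_def algebra_simps sum.distrib scaleR_sum_right)
  have sc: "A *v (c *\<^sub>R y) = c *\<^sub>R (A *v y)" for y and c :: real
    using lin[of 0 c y] by simp
  have sym: "x \<bullet> (A *v y) = (A *v x) \<bullet> y" for x y
    using cip_Herm[OF A, of x y] by (simp add: Re_cip[symmetric])
  have q: "\<mu> * (z \<bullet> z) \<le> z \<bullet> (A *v z)" if "z \<in> W" for z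
  proof (cases "z = 0")
    case False
    let ?c = "1 / norm z"
    have "\<mu> \<le> (?c *\<^sub>R z) \<bullet> (A *v (?c *\<^sub>R z))"
      unfolding \<mu>_def using False that Wsc by (intro min) auto
    also have "A *v (?c *\<^sub>R z) = ?c *\<^sub>R (A *v z)" by (rule sc)
    finally have "\<mu> \<le> (z \<bullet> (A *v z)) / (norm z)\<^sup>2" by (simp add: power2_eq_square)
    then show ?thesis using False by (simp add: pos_le_divide_eq power2_norm_eq_inner)
  qed simp
  \<comment> \<open>The residual of the eigenvalue equation. As it lies in \<open>W\<close>, it is
    an admissible direction of variation, and the first-order coefficient of the form minus
    \<open>\<mu>\<close> times the squared norm in this direction is
    \<open>2 * (z \<bullet> z)\<close>.\<close>
  define z where "z = A *v w0 - \<mu> *\<^sub>R w0"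
  have zW: "z \<in> W" unfolding z_def using w0 WA Wsc Wadd by blast
  have "z \<bullet> z = 0"
  proof (rule nonneg_quadratic_linear_coeff)
    fix t :: real
    have w0w0: "w0 \<bullet> w0 = 1" using w0(1) by (simp add: norm_eq_1)
    have "w0 \<bullet> (A *v z) = z \<bullet> (A *v w0)" using sym[of w0 z] by (simp add: inner_commute)
    then have e1: "(w0 + t *\<^sub>R z) \<bullet> (A *v (w0 + t *\<^sub>R z)) =
        \<mu> + 2 * t * (z \<bullet> (A *v w0)) + t\<^sup>2 * (z \<bullet> (A *v z))"
      by (simp add: lin sc inner_add_left inner_add_right \<mu>_def power2_eq_square algebra_simps)
    have e2: "(w0 + t *\<^sub>R z) \<bullet> (w0 + t *\<^sub>R z) = 1 + 2 * t * (z \<bullet> w0) + t\<^sup>2 * (z \<bullet> z)"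
      using w0w0 by (simp add: inner_add_left inner_add_right inner_commute[of w0 z] power2_eq_square algebra_simps)
    have e3: "2 * t * (z \<bullet> z) = 2 * t * (z \<bullet> (A *v w0)) - \<mu> * (2 * t * (z \<bullet> w0))"
      by (subst (2) z_def) (simp add: inner_diff_right algebra_simps)
    have "\<mu> * ((w0 + t *\<^sub>R z) \<bullet> (w0 + t *\<^sub>R z)) \<le> (w0 + t *\<^sub>R z) \<bullet> (A *v (w0 + t *\<^sub>R z))"
      using w0 zW Wsc Wadd by (intro q) auto
    then show "0 \<le> 2 * t * (z \<bullet> z) + t\<^sup>2 * (z \<bullet> (A *v z) - \<mu> * (z \<bullet> z))"
      unfolding e1 e2 e3 by (simp add: algebra_simps)
  qed
  then have eig: "A *v w0 = complex_of_real \<mu> *s w0"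
    by (simp add: z_def vec_eq_iff) (simp add: scaleR_conv_of_real)
  have 0: "cip (u i) w0 = 0" "cip w0 (u i) = 0" if "i \<in> S" for i
    using w0(2) that cip_commute[of w0 "u i"] by (auto simp: W_def)
  have 1: "cip w0 w0 = 1" using w0(1) by (simp add: cip_self)
  show ?case
    using insert(2) eig ul 0 1
    by (intro exI[of _ "u(a := w0)"] exI[of _ "l(a := \<mu>)"]) auto
qed simp

text \<open>With the eigenvectors as the columns of a constant polynomial matrix \<open>?P\<close>,
  the eigenvalue equations read \<open>?M ** ?P = ?P ** ?D\<close>. Orthonormality makes the
  determinant of \<open>?P\<close> nonzero, so it cancels in the integral domain of
  polynomials.\<close>

lemma charpoly_Herm_eq_prod:
  fixes A :: "complex^'n^'n" and u :: "'n \<Rightarrow> complex^'n"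
  assumes eig: "\<And>i. A *v u i = of_real (l i) *s u i"
    and orth: "\<And>i j. cip (u i) (u j) = (if i = j then 1 else 0)"
  shows "charpoly A = (\<Prod>i\<in>UNIV. [:- of_real (l i), 1:])"
proof -
  let ?M = "(\<chi> i j. (if i = j then [:0, 1:] else 0) - [:A $ i $ j:]) :: complex poly^'n^'n"
  let ?P = "(\<chi> i j. [:u j $ i:]) :: complex poly^'n^'n"
  let ?Q = "(\<chi> i j. [:cnj (u i $ j):]) :: complex poly^'n^'n"
  let ?D = "(\<chi> i j. if i = j then [:- of_real (l i), 1:] else 0) :: complex poly^'n^'n"
  have "(?Q ** ?P) $ i $ j = [:cip (u i) (u j):]" for i j
    by (simp add: matrix_matrix_mult_def sum_to_poly cip_def mult.commute)
  then have "?Q ** ?P = mat 1" by (simp add: vec_eq_iff mat_def orth)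
  then have "det (?Q ** ?P) = 1" by (simp only: det_I)
  then have "det ?Q * det ?P = 1" unfolding det_mul .
  then have P: "det ?P \<noteq> 0" by auto
  have "(?M ** ?P) $ i $ j = (?P ** ?D) $ i $ j" for i j
  proof -
    have "(\<Sum>k\<in>UNIV. A $ i $ k * u j $ k) = of_real (l j) * u j $ i"
      using eig[of j] by (simp add: vec_eq_iff matrix_vector_mult_def)
    moreover have "(?M ** ?P) $ i $ j =
        (\<Sum>k\<in>UNIV. (if i = k then [:0, 1:] * [:u j $ k:] else 0) - [:A $ i $ k * u j $ k:])"
      unfolding matrix_matrix_mult_def vec_lambda_beta by (intro sum.cong) (auto simp: smult_diff_right)
    ultimately have "(?M ** ?P) $ i $ j = [:0, 1:] * [:u j $ i:] - [:of_real (l j) * u j $ i:]"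
      by (simp only: sum_subtractf sum_to_poly) (simp add: sum.delta)
    also have "\<dots> = (?P ** ?D) $ i $ j"
      by (simp add: matrix_matrix_mult_def if_distrib[of "\<lambda>x. _ * x"] sum.delta' mult.commute cong: if_cong)
    finally show ?thesis .
  qed
  then have "?M ** ?P = ?P ** ?D" by (simp add: vec_eq_iff)
  then have "det (?M ** ?P) = det (?P ** ?D)" by (rule arg_cong)
  then have "det ?M * det ?P = det ?P * det ?D" unfolding det_mul .
  moreover have "det ?D = (\<Prod>i\<in>UNIV. [:- of_real (l i), 1:])"
    by (subst det_diagonal) auto
  ultimately show ?thesis using P unfolding charpoly_def by (simp add: mult.commute)
qed

lemma eigenvalue_mset:
  fixes A :: "complex^'n^'n" and u :: "'n \<Rightarrow> complex^'n"
  assumes "\<And>i. A *v u i = of_real (l i) *s u i"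
    and "\<And>i j. cip (u i) (u j) = (if i = j then 1 else 0)"
  shows "image_mset Re (proots (charpoly A)) = image_mset l (mset_set UNIV)"
proof -
  have "(\<Sum>i\<in>S. {#complex_of_real (l i)#}) = image_mset (\<lambda>i. of_real (l i)) (mset_set S)"
    if "finite S" for S :: "'n set"
    using that by (induction S rule: finite_induct) simp_all
  moreover have "proots (\<Prod>i\<in>(UNIV :: 'n set). [:- complex_of_real (l i), 1:]) =
      (\<Sum>i\<in>UNIV. {#complex_of_real (l i)#})"
    by (subst proots_prod) simp_all
  ultimately show ?thesis
    by (simp add: charpoly_Herm_eq_prod[OF assms] multiset.map_comp comp_def)
qed

section \<open>Ky Fan's minimum principle\<close>

text \<open>Orthonormality says that the conjugate transpose is a left inverse of the matrix with
  columns \<open>u j\<close>. For square matrices it is then also a right inverse, which is the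
  expansion.\<close>

lemma orthonormal_basis_expansion:
  fixes u :: "'n \<Rightarrow> complex^'n"
  assumes orth: "\<And>i j. cip (u i) (u j) = (if i = j then 1 else 0)"
  shows "(\<Sum>j\<in>UNIV. cip (u j) w *s u j) = w"
proof -
  let ?P = "(\<chi> i j. u j $ i) :: complex^'n^'n"
  let ?Q = "(\<chi> i j. cnj (u i $ j)) :: complex^'n^'n"
  have "?Q ** ?P = mat 1"
    using orth by (auto simp: vec_eq_iff matrix_matrix_mult_def mat_def cip_def)
  then have "?P ** ?Q = mat 1" by (simp add: matrix_left_right_inverse)
  then have "w = ?P *v (?Q *v w)" by (simp add: matrix_vector_mul_assoc)
  also have "\<dots> = (\<Sum>j\<in>UNIV. cip (u j) w *s u j)"
    by (simp add: vec_eq_iff matrix_vector_mult_def cip_def mult.commute)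
  finally show ?thesis by simp
qed

lemma cip_mult_commute: "cip u v * cip v u = of_real ((cmod (cip u v))\<^sup>2)"
  by (simp only: cip_commute[of v u] complex_norm_square)

lemma norm_eq_1_if_cip:
  assumes "cip v v = 1"
  shows "norm v = 1"
proof -
  have "Re (cip v v) = 1" using assms by simp
  then show ?thesis by (simp add: Re_cip norm_eq_1)
qed

lemma parseval:
  fixes u :: "'n \<Rightarrow> complex^'n"
  assumes "\<And>i j. cip (u i) (u j) = (if i = j then 1 else 0)"
  shows "(\<Sum>j\<in>UNIV. (cmod (cip (u j) v))\<^sup>2) = (norm v)\<^sup>2"
proof -
  have "complex_of_real ((norm v)\<^sup>2) = cip v (\<Sum>j\<in>UNIV. cip (u j) v *s u j)"
    by (simp add: orthonormal_basis_expansion[OF assms] cip_self)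
  also have "\<dots> = of_real (\<Sum>j\<in>UNIV. (cmod (cip (u j) v))\<^sup>2)"
    by (simp add: cip_sum_right cip_scale_right cip_mult_commute)
  finally show ?thesis by (simp only: of_real_eq_iff)
qed

lemma quadratic_form_eigenbasis:
  fixes u :: "'n \<Rightarrow> complex^'n" and A :: "complex^'n^'n"
  assumes A: "A \<in> Herm" and eig: "\<And>i. A *v u i = of_real (l i) *s u i"
    and orth: "\<And>i j. cip (u i) (u j) = (if i = j then 1 else 0)"
  shows "v \<bullet> (A *v v) = (\<Sum>j\<in>UNIV. l j * (cmod (cip (u j) v))\<^sup>2)"
proof -
  have "cip (A *v v) v = cip (A *v v) (\<Sum>j\<in>UNIV. cip (u j) v *s u j)"
    by (simp add: orthonormal_basis_expansion[OF orth])
  also have "\<dots> = (\<Sum>j\<in>UNIV. cip (u j) v * cip v (A *v u j))"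
    by (simp add: cip_sum_right cip_scale_right cip_Herm[OF A])
  also have "\<dots> = (\<Sum>j\<in>UNIV. of_real (l j) * (cip (u j) v * cip v (u j)))"
    by (simp add: eig cip_scale_right mult_ac)
  also have "\<dots> = of_real (\<Sum>j\<in>UNIV. l j * (cmod (cip (u j) v))\<^sup>2)"
    by (simp add: cip_mult_commute)
  finally have "Re (cip (A *v v) v) = (\<Sum>j\<in>UNIV. l j * (cmod (cip (u j) v))\<^sup>2)" by simp
  then show ?thesis by (simp add: Re_cip inner_commute)
qed

text \<open>The residual \<open>r\<close> is orthogonal to every \<open>v i\<close>, so its squared
  norm is exactly the difference of the two sides.\<close>

lemma bessel:
  fixes v :: "'i \<Rightarrow> complex^'n"
  assumes "finite I" and orth: "\<And>i j. i \<in> I \<Longrightarrow> j \<in> I \<Longrightarrow> cip (v i) (v j) = (if i = j then 1 else 0)"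
  shows "(\<Sum>i\<in>I. (cmod (cip (v i) w))\<^sup>2) \<le> (norm w)\<^sup>2"
proof -
  define r where "r = w - (\<Sum>i\<in>I. cip (v i) w *s v i)"
  have 0: "cip (v i) r = 0" if "i \<in> I" for i
  proof -
    have "(\<Sum>j\<in>I. cip (v j) w * cip (v i) (v j)) = (\<Sum>j\<in>I. if i = j then cip (v j) w else 0)"
      using that by (intro sum.cong) (auto simp: orth)
    then show ?thesis
      using that assms(1) by (simp add: r_def cip_diff_right cip_sum_right cip_scale_right)
  qed
  have "of_real ((norm r)\<^sup>2) = cip r (w - (\<Sum>i\<in>I. cip (v i) w *s v i))"
    by (simp add: cip_self r_def[symmetric])
  also have "\<dots> = cip r w - (\<Sum>i\<in>I. cip (v i) w * cip r (v i))"
    by (simp add: cip_diff_right cip_sum_right cip_scale_right)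
  also have "(\<Sum>i\<in>I. cip (v i) w * cip r (v i)) = 0"
    using 0 by (intro sum.neutral) (simp add: cip_commute[of r])
  also have "cip r w - 0 = cnj (cip w r)" by (simp add: cip_commute[of r])
  also have "cip w r = of_real ((norm w)\<^sup>2 - (\<Sum>i\<in>I. (cmod (cip (v i) w))\<^sup>2))"
    by (simp add: r_def cip_diff_right cip_sum_right cip_scale_right cip_self cip_mult_commute)
  finally have "(norm r)\<^sup>2 = (norm w)\<^sup>2 - (\<Sum>i\<in>I. (cmod (cip (v i) w))\<^sup>2)"
    by (simp only: complex_cnj_complex_of_real of_real_eq_iff)
  then show ?thesis using zero_le_power2[of "norm r"] by linarith
qed

text \<open>A total weight \<open>k\<close>, with at most 1 per entry, is cheapest when it sits on
  the \<open>k\<close> smallest entries. After subtracting a threshold that separates these from the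
  others, the inequality holds term by term.\<close>

lemma sum_smallest_le_weighted_sum:
  fixes a w :: "nat \<Rightarrow> real"
  assumes mono: "\<And>i j. i \<le> j \<Longrightarrow> j < d \<Longrightarrow> a i \<le> a j" and w: "\<And>i. i < d \<Longrightarrow> 0 \<le> w i \<and> w i \<le> 1"
    and sum: "(\<Sum>i<d. w i) = real k" and k: "k \<le> d"
  shows "(\<Sum>i<k. a i) \<le> (\<Sum>i<d. a i * w i)"
proof -
  \<comment> \<open>For \<open>k = 0\<close> the truncated subtraction gives \<open>c = a 0\<close>,
    which is still below every \<open>a i\<close>, and the case \<open>i < k\<close> does not
    arise.\<close>
  define c where "c = a (k - 1)"
  have "(if i < k then a i - c else 0) \<le> (a i - c) * w i" if i: "i < d" for i
  proof (cases "i < k")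
    case True
    then have "a i \<le> c" unfolding c_def using k by (intro mono) auto
    then have "(a i - c) * 1 \<le> (a i - c) * w i" using w[OF i] by (intro mult_left_mono_neg) auto
    then show ?thesis using True by simp
  next
    case False
    then have "c \<le> a i" unfolding c_def using i by (intro mono) auto
    then show ?thesis using False w[OF i] by simp
  qed
  then have "(\<Sum>i<d. if i < k then a i - c else 0) \<le> (\<Sum>i<d. (a i - c) * w i)"
    by (intro sum_mono) auto
  also have "\<dots> = (\<Sum>i<d. a i * w i) - c * real k"
    by (simp add: left_diff_distrib sum_subtractf sum_distrib_left[symmetric] sum)
  also have "(\<Sum>i<d. if i < k then a i - c else 0) = (\<Sum>i<k. a i - c)"
    using k by (subst sum.inter_filter[symmetric]) (auto intro!: sum.cong)
  also have "\<dots> = (\<Sum>i<k. a i) - c * real k" by (simp add: sum_subtractf)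
  finally show ?thesis by simp
qed

text \<open>The list behind \<open>eig_up\<close>, indexed by naturals so that its initial sums can
  be written for any finite index type.\<close>

definition nth_eig :: "complex^'n^'n \<Rightarrow> nat \<Rightarrow> real" where
  "nth_eig A i = sorted_list_of_multiset (image_mset Re (proots (charpoly A))) ! i"

text \<open>Sorting an enumeration of the indices by eigenvalue gives \<open>p\<close>. The
  resulting list of eigenvalues is sorted and has the multiset of roots of
  \<open>charpoly A\<close>, hence equals the list defining \<open>nth_eig\<close>.\<close>

lemma Herm_sorted_eigenbasis:
  fixes A :: "complex^'n^'n"
  assumes A: "A \<in> Herm"
  obtains u l p where "\<And>i. A *v u i = of_real (l i) *s u i"
    and "\<And>i j. cip (u i) (u j) = (if i = j then 1 else 0)"
    and "bij_betw p {..<CARD('n)} (UNIV :: 'n set)"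
    and "\<And>i. i < CARD('n) \<Longrightarrow> nth_eig A i = l (p i)"
    and "\<And>i j. i \<le> j \<Longrightarrow> j < CARD('n) \<Longrightarrow> nth_eig A i \<le> nth_eig A j"
proof -
  from Herm_orthonormal_eigenvectors[OF A, of UNIV] obtain u :: "'n \<Rightarrow> complex^'n" and l
    where "\<forall>i\<in>UNIV. A *v u i = of_real (l i) *s u i"
      and "\<forall>i\<in>UNIV. \<forall>j\<in>UNIV. cip (u i) (u j) = (if i = j then 1 else 0)" by blast
  then have u: "\<And>i. A *v u i = of_real (l i) *s u i"
      and o: "\<And>i j. cip (u i) (u j) = (if i = j then 1 else 0)" by blast+
  obtain ys :: "'n list" where ys: "set ys = UNIV" "distinct ys"
    using finite_distinct_list[OF finite] by blast
  define xs where "xs = sort_key l ys"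
  have xs: "set xs = UNIV" "distinct xs" using ys by (simp_all add: xs_def)
  have len: "length xs = CARD('n)" using distinct_card[OF xs(2)] xs(1) by simp
  have sorted: "sorted (map l xs)" unfolding xs_def by (rule sorted_sort_key)
  have "image_mset l (mset_set UNIV) = mset (map l xs)"
    using mset_set_set[OF xs(2)] xs(1) by (simp add: mset_map)
  then have "sorted_list_of_multiset (image_mset Re (proots (charpoly A))) = map l xs"
    using eigenvalue_mset[OF u o] sorted sorted_sort_id by (metis sorted_list_of_multiset_mset)
  then have nth: "nth_eig A i = map l xs ! i" for i by (simp add: nth_eig_def)
  show thesis
  proof (rule that[of u l "\<lambda>i. xs ! i"])
    show "bij_betw (\<lambda>i. xs ! i) {..<CARD('n)} (UNIV :: 'n set)"
      using bij_betw_nth[OF xs(2), of "{..<CARD('n)}" UNIV] len xs(1) by simp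
    show "nth_eig A i = l (xs ! i)" if "i < CARD('n)" for i
      using that len by (simp add: nth)
    show "nth_eig A i \<le> nth_eig A j" if "i \<le> j" "j < CARD('n)" for i j
      using sorted that len unfolding nth by (simp only: sorted_nth_mono length_map)
  qed (simp_all add: u o)
qed

text \<open>Expanding the \<open>v i\<close> in an eigenbasis of \<open>A\<close> turns the
  right-hand side into a weighted sum of eigenvalues. Bessel, applied to the family \<open>v\<close>
  and a vector \<open>u j\<close>, bounds each weight by 1, and Parseval gives the total weight
  \<open>k\<close>.\<close>

lemma ky_fan:
  fixes A :: "complex^'n^'n" and v :: "nat \<Rightarrow> complex^'n"
  assumes A: "A \<in> Herm" and k: "k \<le> CARD('n)"
    and v: "\<And>i j. i < k \<Longrightarrow> j < k \<Longrightarrow> cip (v i) (v j) = (if i = j then 1 else 0)"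
  shows "(\<Sum>i<k. nth_eig A i) \<le> (\<Sum>i<k. v i \<bullet> (A *v v i))"
proof -
  from A obtain u l p where u: "\<And>i. A *v u i = of_real (l i) *s u i"
    and o: "\<And>i j. cip (u i) (u j) = (if i = j then 1 else 0)"
    and p: "bij_betw p {..<CARD('n)} (UNIV :: 'n set)"
    and l: "\<And>i. i < CARD('n) \<Longrightarrow> nth_eig A i = l (p i)"
    and mono: "\<And>i j. i \<le> j \<Longrightarrow> j < CARD('n) \<Longrightarrow> nth_eig A i \<le> nth_eig A j"
    by (rule Herm_sorted_eigenbasis) blast
  have nv: "norm (v i) = 1" if "i < k" for i
    using v[OF that that] by (intro norm_eq_1_if_cip) simp
  have nu: "norm (u i) = 1" for i
    using o[of i i] by (intro norm_eq_1_if_cip) simp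
  define w where "w j = (\<Sum>i<k. (cmod (cip (u j) (v i)))\<^sup>2)" for j
  have w1: "w j \<le> 1" for j
  proof -
    have "w j = (\<Sum>i<k. (cmod (cip (v i) (u j)))\<^sup>2)"
      unfolding w_def by (simp add: cip_commute[of "u j"])
    also have "\<dots> \<le> (norm (u j))\<^sup>2" using v by (intro bessel) auto
    finally show ?thesis by (simp add: nu)
  qed
  have w0: "0 \<le> w j" for j unfolding w_def by (intro sum_nonneg) auto
  have sw: "(\<Sum>j\<in>UNIV. w j) = real k"
    unfolding w_def by (subst sum.swap) (simp add: parseval[OF o] nv)
  have "(\<Sum>i<k. nth_eig A i) \<le> (\<Sum>i<CARD('n). nth_eig A i * w (p i))"
    using w0 w1 sw k mono by (intro sum_smallest_le_weighted_sum) (auto simp: sum.reindex_bij_betw[OF p])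
  also have "\<dots> = (\<Sum>i<CARD('n). l (p i) * w (p i))" by (intro sum.cong) (auto simp: l)
  also have "\<dots> = (\<Sum>j\<in>UNIV. l j * w j)"
    by (rule sum.reindex_bij_betw[OF p])
  also have "\<dots> = (\<Sum>i<k. v i \<bullet> (A *v v i))"
    unfolding w_def quadratic_form_eigenbasis[OF A u o]
    by (simp add: sum_distrib_left sum.swap[of _ "{..<k}"])
  finally show ?thesis .
qed

text \<open>A crude entrywise estimate; what matters is that the bound is the same for all unit
  vectors.\<close>

lemma abs_inner_matrix_vector_le:
  fixes C :: "complex^'n^'n"
  assumes "norm v = 1"
  shows "\<bar>v \<bullet> (C *v v)\<bar> \<le> (real CARD('n))\<^sup>2 * norm C"
proof -
  have v1: "cmod (v $ i) \<le> 1" for i using Finite_Cartesian_Product.norm_nth_le[of v i] assms by simp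
  have C1: "cmod (C $ i $ j) \<le> norm C" for i j
    using Finite_Cartesian_Product.norm_nth_le[of "C $ i" j] Finite_Cartesian_Product.norm_nth_le[of C i] by simp
  have "\<bar>v \<bullet> (C *v v)\<bar> \<le> cmod (cip v (C *v v))"
    by (metis Re_cip abs_Re_le_cmod)
  also have "cip v (C *v v) = (\<Sum>i\<in>UNIV. \<Sum>j\<in>UNIV. cnj (v $ i) * (C $ i $ j * v $ j))"
    by (simp add: cip_def matrix_vector_mult_def sum_distrib_left)
  also have "cmod \<dots> \<le> (\<Sum>i\<in>(UNIV::'n set). \<Sum>j\<in>(UNIV::'n set). norm C)"
  proof (intro sum_norm_le)
    fix i j
    have "cmod (v $ i) * (cmod (C $ i $ j) * cmod (v $ j)) \<le> 1 * (norm C * 1)"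
      using v1 C1 by (intro mult_mono) auto
    then show "cmod (cnj (v $ i) * (C $ i $ j * v $ j)) \<le> norm C" by (simp add: norm_mult)
  qed
  finally show ?thesis by (simp add: power2_eq_square mult.assoc)
qed

lemma linear_quadratic_form: "linear (\<lambda>C. v \<bullet> (C *v (v :: complex^'n)))"
  by (rule linearI)
    (simp_all add: inner_vec_def matrix_vector_mult_def algebra_simps sum.distrib scaleR_sum_right sum_distrib_left
      inner_sum_right inner_add_right)

text \<open>Ky Fan's principle writes the sum of the \<open>k\<close> smallest eigenvalues as a minimum of linear
  functionals with a common bound; a minimising one at \<open>A\<close> is a supergradient there.\<close>

lemma eig_sum_supergradient:
  fixes A :: "complex^'n^'n"
  assumes A: "A \<in> Herm" and k: "k \<le> CARD('n)"
  shows "\<exists>f. linear f \<and> (\<forall>C. \<bar>f C\<bar> \<le> real k * (real CARD('n))\<^sup>2 * norm C) \<and>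
    (\<forall>C\<in>Herm. (\<Sum>i<k. nth_eig C i) \<le> (\<Sum>i<k. nth_eig A i) + f (C - A))"
proof -
  from A obtain u l p where u: "\<And>i. A *v u i = of_real (l i) *s u i"
    and o: "\<And>i j. cip (u i) (u j) = (if i = j then 1 else 0)"
    and p: "bij_betw p {..<CARD('n)} (UNIV :: 'n set)"
    and l: "\<And>i. i < CARD('n) \<Longrightarrow> nth_eig A i = l (p i)"
    by (rule Herm_sorted_eigenbasis) blast
  define v where "v i = u (p i)" for i
  define f where "f C = (\<Sum>i<k. v i \<bullet> (C *v v i))" for C
  have lin: "linear f"
    unfolding f_def by (intro linear_compose_sum ballI linear_quadratic_form)
  have cv: "cip (v i) (v j) = (if i = j then 1 else 0)" if "i < k" "j < k" for i j
    using that k bij_betw_imp_inj_on[OF p] by (auto simp: v_def o inj_on_def)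
  have nv: "norm (v i) = 1" if "i < k" for i
    using cv[OF that that] by (intro norm_eq_1_if_cip) simp
  have bound: "\<bar>f C\<bar> \<le> real k * (real CARD('n))\<^sup>2 * norm C" for C
  proof -
    have "\<bar>f C\<bar> \<le> (\<Sum>i<k. \<bar>v i \<bullet> (C *v v i)\<bar>)" unfolding f_def by (rule sum_abs)
    also have "\<dots> \<le> (\<Sum>i<k. (real CARD('n))\<^sup>2 * norm C)"
      by (intro sum_mono abs_inner_matrix_vector_le nv) auto
    finally show ?thesis by (simp add: mult.assoc)
  qed
  \<comment> \<open>The minimum in Ky Fan's principle is attained, because the \<open>v i\<close>
    are eigenvectors for the \<open>k\<close> smallest eigenvalues of \<open>A\<close>.\<close>
  have fA: "f A = (\<Sum>i<k. nth_eig A i)"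
    unfolding f_def
  proof (intro sum.cong refl)
    fix i assume "i \<in> {..<k}"
    then have i: "i < k" by simp
    have "v i \<bullet> (A *v v i) = Re (of_real (l (p i)) * cip (v i) (v i))"
      by (simp add: Re_cip[symmetric] v_def u cip_scale_right)
    then show "v i \<bullet> (A *v v i) = nth_eig A i" using i k l[of i] cv[OF i i] by simp
  qed
  have "(\<Sum>i<k. nth_eig C i) \<le> (\<Sum>i<k. nth_eig A i) + f (C - A)" if "C \<in> Herm" for C
    using ky_fan[OF that k cv] linear_diff[OF lin, of C A] fA by (simp add: f_def)
  then show ?thesis using lin bound by blast
qed

section \<open>Slopes along curves of functions with supergradients\<close>

text \<open>The supergradients at \<open>B\<close> and at \<open>C\<close> bound the difference from
  the two sides, with the common constant \<open>K\<close>.\<close>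

lemma lipschitz_if_supergradient:
  fixes S :: "'a::real_normed_vector \<Rightarrow> real"
  assumes sg: "\<And>B. B \<in> H \<Longrightarrow> \<exists>l. linear l \<and> (\<forall>C. \<bar>l C\<bar> \<le> K * norm C) \<and> (\<forall>C\<in>H. S C \<le> S B + l (C - B))"
    and "B \<in> H" "C \<in> H"
  shows "\<bar>S B - S C\<bar> \<le> K * norm (B - C)"
proof -
  have *: "S C - S B \<le> K * norm (B - C)" if BC: "B \<in> H" "C \<in> H" for B C
  proof -
    obtain l where l: "\<And>C. \<bar>l C\<bar> \<le> K * norm C" "\<And>C. C \<in> H \<Longrightarrow> S C \<le> S B + l (C - B)"
      using sg[OF BC(1)] by blast
    have "S C - S B \<le> l (C - B)" using l(2)[OF BC(2)] by simp
    also have "\<dots> \<le> K * norm (C - B)" using l(1)[of "C - B"] by simp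
    finally show ?thesis by (simp add: norm_minus_commute)
  qed
  show ?thesis using *[OF assms(2,3)] *[OF assms(3,2)] by (simp add: abs_le_iff norm_minus_commute)
qed

lemma has_vector_derivative_at_0:
  "(g has_vector_derivative D) (at (0::real)) \<longleftrightarrow> ((\<lambda>h. (g h - g 0) /\<^sub>R h) \<longlongrightarrow> D) (at 0)"
proof -
  have "norm ((g h - g 0) /\<^sub>R h - D) = norm (g h - g 0 - h *\<^sub>R D) / norm h" if "h \<noteq> 0" for h
  proof -
    have "(g h - g 0) /\<^sub>R h - D = (g h - g 0 - h *\<^sub>R D) /\<^sub>R h"
      using that by (simp add: algebra_simps)
    then show ?thesis by (simp add: divide_inverse mult.commute)
  qed
  then have "((\<lambda>h. norm ((g h - g 0) /\<^sub>R h - D)) \<longlongrightarrow> 0) (at 0) \<longleftrightarrow>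
      ((\<lambda>h. norm (g h - g 0 - h *\<^sub>R D) / norm h) \<longlongrightarrow> 0) (at 0)"
    by (intro Lim_cong_within) auto
  then show ?thesis
    by (simp add: has_vector_derivative_def has_derivative_iff_norm bounded_linear_scaleR_left
        tendsto_norm_zero_iff LIM_zero_iff)
qed

text \<open>Keeps the tangent line of a curve in \<open>H\<close> inside \<open>H\<close>, where the
  supergradient inequality may be applied.\<close>

lemma vector_derivative_in_subspace:
  assumes H: "subspace H" "closed H"
    and G: "\<And>t. \<bar>t\<bar> < \<delta> \<Longrightarrow> G t \<in> H" "0 < \<delta>" "(G has_vector_derivative D) (at (0::real))"
  shows "D \<in> H"
proof (rule Lim_in_closed_set[OF H(2)])
  show "((\<lambda>h. (G h - G 0) /\<^sub>R h) \<longlongrightarrow> D) (at 0)"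
    using G(3) by (simp add: has_vector_derivative_at_0)
  have "eventually (\<lambda>h. \<bar>h\<bar> < \<delta>) (at (0::real))"
    using G(2) by (auto simp: eventually_at intro!: exI[of _ \<delta>])
  then show "eventually (\<lambda>h. (G h - G 0) /\<^sub>R h \<in> H) (at 0)"
    by (rule eventually_mono) (use G(1,2) H(1) in \<open>auto intro!: subspace_scale subspace_diff\<close>)
qed auto

text \<open>For a supergradient \<open>l\<close> at \<open>G 0\<close>, the function
  \<open>l (G t) - S (G t)\<close> has a local minimum at \<open>0\<close>, so its derivative
  \<open>l D - s\<close> vanishes. Thus \<open>l\<close> has slope exactly \<open>s\<close> in
  direction \<open>D\<close>, and its inequality along the tangent line is the claim.\<close>

lemma supergradient_slope:
  fixes S :: "'a::real_normed_vector \<Rightarrow> real"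
  assumes sg: "\<And>B. B \<in> H \<Longrightarrow> \<exists>l. linear l \<and> (\<forall>C. \<bar>l C\<bar> \<le> K * norm C) \<and> (\<forall>C\<in>H. S C \<le> S B + l (C - B))"
    and H: "subspace H" "closed H"
    and G: "\<And>t. \<bar>t\<bar> < \<delta> \<Longrightarrow> G t \<in> H" "0 < \<delta>" "(G has_vector_derivative D) (at (0::real))"
    and s: "((\<lambda>t. S (G t)) has_real_derivative s) (at 0)"
  shows "S (G 0 + h *\<^sub>R D) \<le> S (G 0) + h * s"
proof -
  have 0: "G 0 \<in> H" using G by simp
  have D: "D \<in> H" using vector_derivative_in_subspace[OF H G] .
  obtain l where l: "linear l" "\<And>C. \<bar>l C\<bar> \<le> K * norm C" "\<And>C. C \<in> H \<Longrightarrow> S C \<le> S (G 0) + l (C - G 0)"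
    using sg[OF 0] by blast
  have "bounded_linear l"
    using l(1,2) by (intro bounded_linear_intro[where K = K])
      (auto simp: linear_add linear_scale mult.commute)
  then have "((\<lambda>t. l (G t)) has_vector_derivative l D) (at 0)"
    using G(3) by (rule bounded_linear.has_vector_derivative)
  then have "((\<lambda>t. l (G t) - S (G t)) has_real_derivative l D - s) (at 0)"
    using s by (intro DERIV_diff) (simp_all add: has_real_derivative_iff_has_vector_derivative)
  moreover have "l (G 0) - S (G 0) \<le> l (G t) - S (G t)" if "\<bar>0 - t\<bar> < \<delta>" for t
    using l(3)[OF G(1), of t] that by (simp add: linear_diff[OF l(1)])
  ultimately have "l D - s = 0"
    using G(2) by (intro DERIV_local_min[where d = \<delta>]) auto
  moreover have "S (G 0 + h *\<^sub>R D) \<le> S (G 0) + l (h *\<^sub>R D)"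
    using l(3)[of "G 0 + h *\<^sub>R D"] 0 D H(1) by (simp add: subspace_add subspace_scale)
  ultimately show ?thesis by (simp add: linear_scale[OF l(1)])
qed

text \<open>By the Lipschitz bound, replacing the curve by its tangent line changes the difference
  quotient of \<open>S\<close> by at most \<open>K\<close> times the error in the derivative of
  \<open>G\<close>.\<close>

lemma supergradient_slope_limit:
  fixes S :: "'a::real_normed_vector \<Rightarrow> real"
  assumes sg: "\<And>B. B \<in> H \<Longrightarrow> \<exists>l. linear l \<and> (\<forall>C. \<bar>l C\<bar> \<le> K * norm C) \<and> (\<forall>C\<in>H. S C \<le> S B + l (C - B))"
    and H: "subspace H" "closed H"
    and G: "\<And>t. \<bar>t\<bar> < \<delta> \<Longrightarrow> G t \<in> H" "0 < \<delta>" "(G has_vector_derivative D) (at (0::real))"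
    and s: "((\<lambda>t. S (G t)) has_real_derivative s) (at 0)"
  shows "((\<lambda>h. (S (G 0 + h *\<^sub>R D) - S (G 0)) / h) \<longlongrightarrow> s) (at 0)"
proof -
  have 0: "G 0 \<in> H" using G by simp
  have D: "D \<in> H" using vector_derivative_in_subspace[OF H G] .
  have "((\<lambda>h. (S (G h) - S (G 0)) / h) \<longlongrightarrow> s) (at 0)"
    using s by (simp add: has_field_derivative_iff)
  moreover have "((\<lambda>h. (S (G 0 + h *\<^sub>R D) - S (G h)) / h) \<longlongrightarrow> 0) (at 0)"
  proof (rule Lim_null_comparison)
    have "((\<lambda>h. (G h - G 0) /\<^sub>R h) \<longlongrightarrow> D) (at 0)"
      using G(3) by (simp add: has_vector_derivative_at_0)
    then have "((\<lambda>h. K * norm ((G h - G 0) /\<^sub>R h - D)) \<longlongrightarrow> K * norm (D - D)) (at 0)"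
      by (intro tendsto_intros)
    then show "((\<lambda>h. K * norm ((G h - G 0) /\<^sub>R h - D)) \<longlongrightarrow> 0) (at 0)" by simp
    have "eventually (\<lambda>h. h \<noteq> 0 \<and> \<bar>h\<bar> < \<delta>) (at (0::real))"
      using G(2) by (auto simp: eventually_at intro!: exI[of _ \<delta>])
    then show "eventually (\<lambda>h. norm ((S (G 0 + h *\<^sub>R D) - S (G h)) / h)
        \<le> K * norm ((G h - G 0) /\<^sub>R h - D)) (at 0)"
    proof (rule eventually_mono)
      fix h :: real assume h: "h \<noteq> 0 \<and> \<bar>h\<bar> < \<delta>"
      have "\<bar>S (G 0 + h *\<^sub>R D) - S (G h)\<bar> \<le> K * norm (G 0 + h *\<^sub>R D - G h)"
        using lipschitz_if_supergradient[of H K S] sg 0 D G(1) h H(1)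
        by (simp add: subspace_add subspace_scale)
      also have "G 0 + h *\<^sub>R D - G h = (- h) *\<^sub>R ((G h - G 0) /\<^sub>R h - D)"
        using h by (simp add: algebra_simps)
      finally have "\<bar>S (G 0 + h *\<^sub>R D) - S (G h)\<bar> \<le> \<bar>h\<bar> * (K * norm ((G h - G 0) /\<^sub>R h - D))"
        by (simp only: norm_scaleR abs_minus_cancel mult_ac)
      then show "norm ((S (G 0 + h *\<^sub>R D) - S (G h)) / h) \<le> K * norm ((G h - G 0) /\<^sub>R h - D)"
        using h by (simp add: divide_le_eq mult.commute)
    qed
  qed
  ultimately have "((\<lambda>h. (S (G h) - S (G 0)) / h + (S (G 0 + h *\<^sub>R D) - S (G h)) / h) \<longlongrightarrow> s + 0) (at 0)"
    by (rule tendsto_add)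
  then show ?thesis by (simp add: add_divide_distrib[symmetric])
qed

text \<open>For fixed \<open>h > 0\<close> (respectively \<open>h < 0\<close>) the difference quotient of step \<open>h\<close> along
  the tangent line is a lower (upper) bound for the slope, and it depends continuously on the base
  point and the direction.\<close>

lemma supergradient_slope_tendsto:
  fixes S :: "'a::real_normed_vector \<Rightarrow> real"
  assumes sg: "\<And>B. B \<in> H \<Longrightarrow> \<exists>l. linear l \<and> (\<forall>C. \<bar>l C\<bar> \<le> K * norm C) \<and> (\<forall>C\<in>H. S C \<le> S B + l (C - B))"
    and H: "subspace H" "closed H" and \<delta>: "0 < \<delta>"
    and G: "\<And>n t. \<bar>t\<bar> < \<delta> \<Longrightarrow> G n t \<in> H" "\<And>n. (G n has_vector_derivative D n) (at (0::real))"
    and s: "\<And>n. ((\<lambda>t. S (G n t)) has_real_derivative s n) (at 0)"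
    and G0: "\<And>t. \<bar>t\<bar> < \<delta> \<Longrightarrow> G0 t \<in> H" "(G0 has_vector_derivative D0) (at (0::real))"
    and s0: "((\<lambda>t. S (G0 t)) has_real_derivative s0) (at 0)"
    and lim: "(\<lambda>n. G n 0) \<longlonglongrightarrow> G0 0" "D \<longlonglongrightarrow> D0"
  shows "s \<longlonglongrightarrow> s0"
proof -
  define q where "q n h = (S (G n 0 + h *\<^sub>R D n) - S (G n 0)) / h" for n h
  define q0 where "q0 h = (S (G0 0 + h *\<^sub>R D0) - S (G0 0)) / h" for h
  have DH: "D n \<in> H" "D0 \<in> H" for n
    using vector_derivative_in_subspace[OF H G(1) \<delta> G(2)] vector_derivative_in_subspace[OF H G0(1) \<delta> G0(2)]
    by blast+
  have slope: "S (G n 0 + h *\<^sub>R D n) \<le> S (G n 0) + h * s n" for n h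
    by (rule supergradient_slope[OF sg H G(1) \<delta> G(2) s]) auto
  have contS: "(\<lambda>n. S (X n)) \<longlonglongrightarrow> S X0" if X: "X \<longlonglongrightarrow> X0" "\<And>n. X n \<in> H" "X0 \<in> H" for X :: "nat \<Rightarrow> 'a" and X0
  proof -
    have "(\<lambda>n. S (X n) - S X0) \<longlonglongrightarrow> 0"
    proof (rule Lim_null_comparison)
      show "eventually (\<lambda>n. norm (S (X n) - S X0) \<le> K * norm (X n - X0)) sequentially"
        using lipschitz_if_supergradient[of H K S] sg X(2,3) by simp
      have "(\<lambda>n. K * norm (X n - X0)) \<longlonglongrightarrow> K * norm (X0 - X0)" by (intro tendsto_intros X)
      then show "(\<lambda>n. K * norm (X n - X0)) \<longlonglongrightarrow> 0" by simp
    qed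
    then show ?thesis by (simp add: LIM_zero_iff)
  qed
  have qlim: "(\<lambda>n. q n h) \<longlonglongrightarrow> q0 h" if "h \<noteq> 0" for h
    unfolding q_def q0_def using that lim G(1) G0(1) \<delta> DH H(1)
    by (intro tendsto_intros contS) (auto intro!: subspace_add subspace_scale tendsto_intros)
  have q0lim: "(q0 \<longlongrightarrow> s0) (at 0)"
    unfolding q0_def by (rule supergradient_slope_limit[OF sg H G0(1) \<delta> G0(2) s0]) auto
  show ?thesis
  proof (rule order_tendstoI)
    \<comment> \<open>The step \<open>d / 2\<close> is fixed first, using only the limit curve; then
      \<open>n\<close> grows with the step held fixed. No uniformity in \<open>n\<close> of the
      convergence of difference quotients is involved.\<close>
    fix a assume "a < s0"
    with q0lim have "eventually (\<lambda>h. a < q0 h) (at 0)" by (rule order_tendstoD)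
    then obtain d where "d > 0" "\<And>h. h \<noteq> 0 \<Longrightarrow> \<bar>h\<bar> < d \<Longrightarrow> a < q0 h"
      by (auto simp: eventually_at)
    then have h: "0 < d / 2" "a < q0 (d / 2)" by auto
    from qlim[of "d / 2"] h have "eventually (\<lambda>n. a < q n (d / 2)) sequentially"
      by (intro order_tendstoD(1)) auto
    then show "eventually (\<lambda>n. a < s n) sequentially"
    proof (rule eventually_mono)
      fix n assume "a < q n (d / 2)"
      also have "q n (d / 2) \<le> s n"
        unfolding q_def using slope[of n "d / 2"] h(1) by (simp add: pos_divide_le_eq mult.commute)
      finally show "a < s n" .
    qed
  next
    fix a assume "s0 < a"
    with q0lim have "eventually (\<lambda>h. q0 h < a) (at 0)" by (rule order_tendstoD)
    then obtain d where "d > 0" "\<And>h. h \<noteq> 0 \<Longrightarrow> \<bar>h\<bar> < d \<Longrightarrow> q0 h < a"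
      by (auto simp: eventually_at)
    then have h: "- d / 2 < 0" "q0 (- d / 2) < a" by auto
    from qlim[of "- d / 2"] h have "eventually (\<lambda>n. q n (- d / 2) < a) sequentially"
      by (intro order_tendstoD(2)) auto
    then show "eventually (\<lambda>n. s n < a) sequentially"
    proof (rule eventually_mono)
      fix n assume "q n (- d / 2) < a"
      moreover have "s n \<le> q n (- d / 2)"
        unfolding q_def using slope[of n "- d / 2"] h(1)
        by (subst neg_le_divide_eq) (auto simp: mult.commute)
      ultimately show "s n < a" by simp
    qed
  qed
qed

section \<open>The characteristic map\<close>

lemma subspace_Herm: "subspace (Herm :: (complex^'n^'n) set)"
  unfolding subspace_def Herm_def by (auto simp: complex_eq_iff simp flip: mult_minus_right)

lemma closed_Herm: "closed (Herm :: (complex^'n^'n) set)"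
proof -
  have eq: "Herm = (\<Inter>i. \<Inter>j. {A :: complex^'n^'n. cnj (A $ j $ i) = A $ i $ j})"
    by (auto simp: Herm_def)
  show ?thesis
    unfolding eq by (intro closed_INT ballI closed_Collect_eq continuous_intros)
qed

text \<open>A single eigenvalue is the difference of two consecutive sums, each Lipschitz with
  constant \<open>CARD('n) ^ 3\<close>. The constant is not sharp, but any finite one gives
  differentiability almost everywhere.\<close>

lemma nth_eig_lipschitz:
  fixes B C :: "complex^'n^'n"
  assumes "B \<in> Herm" "C \<in> Herm" "i < CARD('n)"
  shows "\<bar>nth_eig B i - nth_eig C i\<bar> \<le> 2 * real CARD('n) ^ 3 * norm (B - C)"
proof -
  let ?S = "\<lambda>k A. \<Sum>i<k. nth_eig A i"
  have S: "\<bar>?S k B - ?S k C\<bar> \<le> real CARD('n) ^ 3 * norm (B - C)" if k: "k \<le> CARD('n)" for k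
  proof -
    have "\<bar>?S k B - ?S k C\<bar> \<le> real k * (real CARD('n))\<^sup>2 * norm (B - C)"
      using eig_sum_supergradient[OF _ k] assms by (intro lipschitz_if_supergradient) auto
    also have "\<dots> \<le> real CARD('n) * (real CARD('n))\<^sup>2 * norm (B - C)"
      using k by (intro mult_right_mono) auto
    finally show ?thesis by (simp add: power3_eq_cube power2_eq_square mult.assoc)
  qed
  have eq: "nth_eig A i = ?S (Suc i) A - ?S i A" for A :: "complex^'n^'n" by simp
  show ?thesis using S[of "Suc i"] S[of i] assms(3) eq[of B] eq[of C] by linarith
qed

section \<open>Positions of eigenvalues and regularity of the characteristic map\<close>

definition index_rank :: "'d::{finite,linorder} \<Rightarrow> nat" where
  "index_rank k = card {j. j < k}"

lemma bij_betw_index_rank: "bij_betw index_rank (UNIV :: 'd::{finite,linorder} set) {..<CARD('d)}"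
proof -
  have less: "index_rank k < index_rank k'" if "k < k'" for k k' :: 'd
    unfolding index_rank_def using that by (intro psubset_card_mono) auto
  have inj: "inj (index_rank :: 'd \<Rightarrow> nat)"
  proof (rule linorder_injI)
    fix k k' :: 'd assume "k < k'"
    then show "index_rank k \<noteq> index_rank k'" using less[of k k'] by simp
  qed
  have "index_rank k < CARD('d)" for k :: 'd
    unfolding index_rank_def by (intro psubset_card_mono) auto
  then have "range (index_rank :: 'd \<Rightarrow> nat) = {..<CARD('d)}"
    using inj by (intro card_subset_eq) (auto simp: card_image)
  with inj show ?thesis by (simp add: bij_betw_def)
qed

lemma index_rank_less: "index_rank (k :: 'd::{finite,linorder}) < CARD('d)"
  using bij_betw_index_rank[where 'd = 'd] by (auto simp: bij_betw_def)

lemma eig_up_nth: "eig_up A $ k = nth_eig A (index_rank k)"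
  by (simp add: eig_up_def nth_eig_def index_rank_def)

lemma eig_up_lipschitz: "\<exists>L. L-lipschitz_on (Herm :: (complex^'d::_^'d::{finite,linorder}) set) eig_up"
proof (intro exI lipschitz_onI)
  let ?n = "real CARD('d)"
  fix B C :: "complex^'d::_^'d::_" assume BC: "B \<in> Herm" "C \<in> Herm"
  have "norm (eig_up B - eig_up C) \<le> (\<Sum>k\<in>UNIV. \<bar>(eig_up B - eig_up C) $ k\<bar>)"
    by (rule norm_le_l1_cart)
  also have "\<dots> \<le> (\<Sum>k\<in>(UNIV :: 'd set). 2 * ?n ^ 3 * norm (B - C))"
    using nth_eig_lipschitz[OF BC index_rank_less] by (intro sum_mono) (simp add: eig_up_nth)
  finally show "dist (eig_up B) (eig_up C) \<le> ?n * (2 * ?n ^ 3) * dist B C"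
    by (simp add: dist_norm mult.assoc)
qed simp

lemma C01_lipschitz_on_cball:
  assumes "f \<in> C01 U" "cball x r \<subseteq> U"
  shows "\<exists>L. L-lipschitz_on (cball x r) f"
proof (cases "0 < r")
  case True
  then have "relatively_compact_open (ball x r) U"
    using assms(2) by (auto simp: relatively_compact_open_def)
  then have "f \<in> C01_closure (ball x r)" using assms(1) by (auto simp: C01_def)
  then show ?thesis using True by (simp add: C01_closure_def)
next
  \<comment> \<open>For \<open>r \<le> 0\<close> the closed ball has at most one point. These radii
    are included because the differentiability lemma quantifies over all closed balls in
    \<open>U\<close>.\<close>
  case False
  then have "cball x r \<subseteq> cball x 0" by (intro subset_cball) simp
  then have "cball x r \<subseteq> {x}" by simp
  then have "0-lipschitz_on (cball x r) f" by (auto simp: lipschitz_on_def)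
  then show ?thesis by blast
qed

lemma C01_char_map_lipschitz_on_cball:
  fixes f :: "real^'m \<Rightarrow> complex^'d::_^'d::{finite,linorder}"
  assumes "f \<in> C01 U" "cball x r \<subseteq> U"
  shows "\<exists>L. L-lipschitz_on (cball x r) (char_map f)"
proof -
  obtain L where L: "L-lipschitz_on (cball x r) f" using C01_lipschitz_on_cball[OF assms] by blast
  obtain K where K: "K-lipschitz_on (Herm :: (complex^'d::_^'d::_) set) eig_up" using eig_up_lipschitz by blast
  have "f ` cball x r \<subseteq> Herm" using assms by (auto simp: C01_def)
  then have "K-lipschitz_on (f ` cball x r) eig_up" using K lipschitz_on_subset by blast
  then have "(K * L)-lipschitz_on (cball x r) (eig_up \<circ> f)" using L lipschitz_on_compose by blast
  then show ?thesis unfolding char_map_def by blast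
qed

lemma AE_partially_differentiable:
  fixes f :: "real^'m \<Rightarrow> 'b::euclidean_space"
  assumes "open U" "\<And>x r. cball x r \<subseteq> U \<Longrightarrow> \<exists>L. L-lipschitz_on (cball x r) f"
  shows "AE x in lebesgue. x \<in> U \<longrightarrow> partially_differentiable_at j f x"
  unfolding partially_differentiable_at_def
  by (rule AE_completion, rule AE_directionally_differentiable[OF assms])

lemma has_vector_derivative_partial_deriv:
  assumes "partially_differentiable_at j f x"
  shows "((\<lambda>t. f (x + t *\<^sub>R axis j 1)) has_vector_derivative partial_deriv j f x) (at (0::real))"
  using assms unfolding partially_differentiable_at_def partial_deriv_def
  by (simp add: vector_derivative_works)

section \<open>Consequences of \<open>C01\<close> convergence at a point\<close>

lemma C01_norm_bounds_value:
  assumes "x \<in> V"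
  shows "ennreal (norm (f x)) \<le> C01_norm V f"
proof -
  have "ennreal (norm (f x)) \<le> (SUP x\<in>V. ennreal (norm (f x)))" using assms by (rule SUP_upper)
  then show ?thesis unfolding C01_norm_def by (simp add: add_increasing2)
qed

text \<open>As \<open>V\<close> is open, the quotients at \<open>x\<close> with small step are among
  those in the second supremum of \<open>C01_norm\<close>, and the bound passes to their
  limit.\<close>

lemma C01_norm_bounds_partial_deriv:
  fixes f :: "real^'m \<Rightarrow> complex^'d^'d"
  assumes V: "open V" "x \<in> V"
    and D: "((\<lambda>t. f (x + t *\<^sub>R axis j 1)) has_vector_derivative D) (at (0::real))"
  shows "ennreal (norm D) \<le> C01_norm V f"
proof (rule tendsto_upperbound)
  let ?e = "axis j 1 :: real^'m"
  let ?q = "\<lambda>h. (f (x + h *\<^sub>R ?e) - f x) /\<^sub>R h"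
  have "(?q \<longlongrightarrow> D) (at 0)" using D by (simp add: has_vector_derivative_at_0)
  then show "((\<lambda>h. ennreal (norm (?q h))) \<longlongrightarrow> ennreal (norm D)) (at 0)"
    by (intro tendsto_intros tendsto_ennrealI)
  obtain r where r: "r > 0" "ball x r \<subseteq> V" using V openE by blast
  have "eventually (\<lambda>h. h \<noteq> 0 \<and> \<bar>h\<bar> < r) (at (0::real))"
    using r(1) by (auto simp: eventually_at intro!: exI[of _ r])
  then show "eventually (\<lambda>h. ennreal (norm (?q h)) \<le> C01_norm V f) (at 0)"
  proof (rule eventually_mono)
    fix h :: real assume h: "h \<noteq> 0 \<and> \<bar>h\<bar> < r"
    let ?y = "x + h *\<^sub>R ?e"
    have n: "norm (?y - x) = \<bar>h\<bar>" by (simp add: norm_axis_1)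
    then have "?y \<in> V" using h r(2) by (auto simp: dist_norm norm_minus_commute norm_axis_1)
    moreover have "?y \<noteq> x" using n h by auto
    ultimately have "(?y, x) \<in> {(x, y). x \<in> V \<and> y \<in> V \<and> x \<noteq> y}" using V(2) by simp
    then have "ennreal (norm (f ?y - f x) / norm (?y - x)) \<le>
        (SUP (x, y)\<in>{(x, y). x \<in> V \<and> y \<in> V \<and> x \<noteq> y}. ennreal (norm (f x - f y) / norm (x - y)))"
      by (rule SUP_upper2) simp
    moreover have "norm (?q h) = norm (f ?y - f x) / norm (?y - x)"
      by (simp add: n divide_inverse mult.commute)
    ultimately show "ennreal (norm (?q h)) \<le> C01_norm V f"
      unfolding C01_norm_def by (simp add: add_increasing)
  qed
qed simp

lemma tendsto_zero_if_ennreal_norm_le: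
  assumes "\<And>n. ennreal (norm (f n)) \<le> N n" "N \<longlonglongrightarrow> 0"
  shows "f \<longlonglongrightarrow> 0"
proof -
  have "(\<lambda>n. ennreal (norm (f n))) \<longlonglongrightarrow> 0"
    by (rule tendsto_sandwich[OF _ _ tendsto_const assms(2)]) (use assms(1) in auto)
  then have "(\<lambda>n. norm (f n)) \<longlonglongrightarrow> 0"
    by (simp add: ennreal_0[symmetric] tendsto_ennreal_iff del: ennreal_0)
  then show ?thesis by (rule tendsto_norm_zero_cancel)
qed

text \<open>Both limits come from applying the pointwise bounds to \<open>A n - A\<^sub>0\<close> on
  one small ball around \<open>x\<close> with compact closure in \<open>U\<close>.\<close>

lemma C01_tendsto_partial_deriv:
  assumes U: "open U" "x \<in> U" and lim: "C01_tendsto U A A\<^sub>0"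
    and A: "\<And>n. partially_differentiable_at j (A n) x"
    and A0: "partially_differentiable_at j A\<^sub>0 x"
  shows "(\<lambda>n. A n x) \<longlonglongrightarrow> A\<^sub>0 x"
    and "(\<lambda>n. partial_deriv j (A n) x) \<longlonglongrightarrow> partial_deriv j A\<^sub>0 x"
proof -
  obtain r where r: "r > 0" "cball x r \<subseteq> U" using U open_contains_cball by blast
  define V where "V = ball x r"
  have V: "open V" "x \<in> V" using r(1) by (auto simp: V_def)
  have "relatively_compact_open V U" using r by (auto simp: V_def relatively_compact_open_def)
  then have N: "(\<lambda>n. C01_norm V (\<lambda>x. A n x - A\<^sub>0 x)) \<longlonglongrightarrow> 0"
    using lim by (simp add: C01_tendsto_def)
  have "(\<lambda>n. A n x - A\<^sub>0 x) \<longlonglongrightarrow> 0"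
    using C01_norm_bounds_value[OF V(2)] by (rule tendsto_zero_if_ennreal_norm_le[OF _ N])
  then show "(\<lambda>n. A n x) \<longlonglongrightarrow> A\<^sub>0 x" by (simp add: LIM_zero_iff)
  have "ennreal (norm (partial_deriv j (A n) x - partial_deriv j A\<^sub>0 x)) \<le> C01_norm V (\<lambda>x. A n x - A\<^sub>0 x)" for n
    by (intro C01_norm_bounds_partial_deriv[OF V, where j = j] has_vector_derivative_diff
        has_vector_derivative_partial_deriv A A0)
  then have "(\<lambda>n. partial_deriv j (A n) x - partial_deriv j A\<^sub>0 x) \<longlonglongrightarrow> 0"
    by (rule tendsto_zero_if_ennreal_norm_le[OF _ N])
  then show "(\<lambda>n. partial_deriv j (A n) x) \<longlonglongrightarrow> partial_deriv j A\<^sub>0 x" by (simp add: LIM_zero_iff)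
qed

section \<open>Convergence of the derivatives of the eigenvalues\<close>

text \<open>The eigenvalue in position \<open>i\<close> is the component of
  \<open>char_map f\<close> at the index of rank \<open>i\<close>, so the sums inherit their
  derivatives from the components.\<close>

lemma has_real_derivative_eig_sum:
  fixes f :: "real^'m \<Rightarrow> complex^'d::_^'d::{finite,linorder}"
  assumes "partially_differentiable_at j (char_map f) x" "k \<le> CARD('d)"
  shows "((\<lambda>t. \<Sum>i<k. nth_eig (f (x + t *\<^sub>R axis j 1)) i) has_real_derivative
    (\<Sum>i<k. partial_deriv j (char_map f) x $ the_inv index_rank i)) (at 0)"
proof (rule DERIV_sum)
  fix i assume "i \<in> {..<k}"
  then have "i \<in> range (index_rank :: 'd \<Rightarrow> nat)" using assms(2) bij_betw_index_rank[where 'd = 'd] by (auto simp: bij_betw_def)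
  then have i: "index_rank (the_inv index_rank i :: 'd) = i"
    using bij_betw_index_rank[where 'd = 'd] by (auto simp: bij_betw_def f_the_inv_into_f)
  have "((\<lambda>t. char_map f (x + t *\<^sub>R axis j 1) $ the_inv index_rank i) has_vector_derivative
      partial_deriv j (char_map f) x $ the_inv index_rank i) (at 0)"
    by (intro bounded_linear.has_vector_derivative[OF bounded_linear_vec_nth]
        has_vector_derivative_partial_deriv assms(1))
  then show "((\<lambda>t. nth_eig (f (x + t *\<^sub>R axis j 1)) i) has_real_derivative
      partial_deriv j (char_map f) x $ the_inv index_rank i) (at 0)"
    by (simp add: char_map_def eig_up_nth i has_real_derivative_iff_has_vector_derivative)
qed

text \<open>The argument at one fixed point: the slope convergence is applied, for each
  \<open>k\<close>, to the curves \<open>A n (x + t *\<^sub>R axis j 1)\<close> and to the sum of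
  the \<open>k\<close> smallest eigenvalues.\<close>

lemma char_map_partial_deriv_tendsto:
  fixes A :: "nat \<Rightarrow> real^'m \<Rightarrow> complex^'d::_^'d::{finite,linorder}"
  assumes U: "open U" "x \<in> U" and A: "\<And>n. A n \<in> C01 U" and A0: "A\<^sub>0 \<in> C01 U" and lim: "C01_tendsto U A A\<^sub>0"
    and dA: "\<And>n. partially_differentiable_at j (A n) x"
    and dA0: "partially_differentiable_at j A\<^sub>0 x"
    and dE: "\<And>n. partially_differentiable_at j (char_map (A n)) x"
    and dE0: "partially_differentiable_at j (char_map A\<^sub>0) x"
  shows "(\<lambda>n. partial_deriv j (char_map (A n)) x) \<longlonglongrightarrow> partial_deriv j (char_map A\<^sub>0) x"
proof -
  let ?e = "axis j 1 :: real^'m"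
  let ?\<sigma> = "\<lambda>f i. partial_deriv j (char_map f) x $ (the_inv index_rank i :: 'd)"
  obtain \<delta> where \<delta>: "\<delta> > 0" "ball x \<delta> \<subseteq> U" using U openE by blast
  have "x + t *\<^sub>R ?e \<in> U" if "\<bar>t\<bar> < \<delta>" for t
    using that by (intro subsetD[OF \<delta>(2)]) (simp add: dist_norm norm_axis_1)
  then have H: "A n (x + t *\<^sub>R ?e) \<in> Herm" "A\<^sub>0 (x + t *\<^sub>R ?e) \<in> Herm" if "\<bar>t\<bar> < \<delta>" for n t
    using that A[of n] A0 by (auto simp: C01_def)
  have sums: "(\<lambda>n. \<Sum>i<k. ?\<sigma> (A n) i) \<longlonglongrightarrow> (\<Sum>i<k. ?\<sigma> A\<^sub>0 i)" if k: "k \<le> CARD('d)" for k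
  proof (rule supergradient_slope_tendsto[OF eig_sum_supergradient[OF _ k] subspace_Herm closed_Herm \<delta>(1)
        H(1) has_vector_derivative_partial_deriv[OF dA] has_real_derivative_eig_sum[OF dE k]
        H(2) has_vector_derivative_partial_deriv[OF dA0] has_real_derivative_eig_sum[OF dE0 k]])
    show "(\<lambda>n. A n (x + 0 *\<^sub>R ?e)) \<longlonglongrightarrow> A\<^sub>0 (x + 0 *\<^sub>R ?e)"
      using C01_tendsto_partial_deriv(1)[OF U lim dA dA0] by simp
    show "(\<lambda>n. partial_deriv j (A n) x) \<longlonglongrightarrow> partial_deriv j A\<^sub>0 x"
      by (rule C01_tendsto_partial_deriv(2)[OF U lim dA dA0])
  qed
  show ?thesis
  proof (rule vec_tendstoI)
    fix m :: 'd
    have m: "the_inv index_rank (index_rank m) = m"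
      using bij_betw_index_rank[where 'd = 'd] by (simp add: bij_betw_def the_inv_f_f)
    \<comment> \<open>Subtracting consecutive sums isolates the component at
      \<open>m\<close>.\<close>
    have "(\<lambda>n. (\<Sum>i<Suc (index_rank m). ?\<sigma> (A n) i) - (\<Sum>i<index_rank m. ?\<sigma> (A n) i)) \<longlonglongrightarrow>
        (\<Sum>i<Suc (index_rank m). ?\<sigma> A\<^sub>0 i) - (\<Sum>i<index_rank m. ?\<sigma> A\<^sub>0 i)"
      using index_rank_less[of m] by (intro tendsto_diff sums) auto
    then show "(\<lambda>n. partial_deriv j (char_map (A n)) x $ m) \<longlonglongrightarrow> partial_deriv j (char_map A\<^sub>0) x $ m"
      by (simp add: m)
  qed
qed

theorem theorem1p7:
  fixes U :: "(real^'m) set"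
    and A :: "nat \<Rightarrow> real^'m \<Rightarrow> complex^'d::_^'d::{finite,linorder}"
    and A\<^sub>0 :: "real^'m \<Rightarrow> complex^'d::_^'d::{finite,linorder}"
  assumes "open U"
    and "\<And>n. A n \<in> C01 U"
    and "A\<^sub>0 \<in> C01 U"
    and "C01_tendsto U A A\<^sub>0"
  shows "\<forall>j. AE x in lebesgue. x \<in> U \<longrightarrow>
           (\<forall>n. partially_differentiable_at j (char_map (A n)) x) \<and>
           partially_differentiable_at j (char_map A\<^sub>0) x \<and>
           (\<lambda>n. partial_deriv j (char_map (A n)) x) \<longlonglongrightarrow> partial_deriv j (char_map A\<^sub>0) x"
proof
  fix j
  \<comment> \<open>Slope convergence at a point asks for derivatives of the matrix maps as well as
    of their eigenvalues. The sequence is countable, so the exceptional sets of all these maps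
    together remain null.\<close>
  have "AE x in lebesgue. \<forall>n. x \<in> U \<longrightarrow> partially_differentiable_at j (A n) x"
    unfolding AE_all_countable
    by (intro allI AE_partially_differentiable assms(1) C01_lipschitz_on_cball[OF assms(2)])
  moreover have "AE x in lebesgue. \<forall>n. x \<in> U \<longrightarrow> partially_differentiable_at j (char_map (A n)) x"
    unfolding AE_all_countable
    by (intro allI AE_partially_differentiable assms(1) C01_char_map_lipschitz_on_cball[OF assms(2)])
  moreover have "AE x in lebesgue. x \<in> U \<longrightarrow> partially_differentiable_at j A\<^sub>0 x"
    by (intro AE_partially_differentiable assms(1) C01_lipschitz_on_cball[OF assms(3)])
  moreover have "AE x in lebesgue. x \<in> U \<longrightarrow> partially_differentiable_at j (char_map A\<^sub>0) x"
    by (intro AE_partially_differentiable assms(1) C01_char_map_lipschitz_on_cball[OF assms(3)])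
  ultimately show "AE x in lebesgue. x \<in> U \<longrightarrow>
           (\<forall>n. partially_differentiable_at j (char_map (A n)) x) \<and>
           partially_differentiable_at j (char_map A\<^sub>0) x \<and>
           (\<lambda>n. partial_deriv j (char_map (A n)) x) \<longlonglongrightarrow> partial_deriv j (char_map A\<^sub>0) x"
    by eventually_elim (use assms in \<open>blast intro: char_map_partial_deriv_tendsto\<close>)
qed

end
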